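(* Let $a:\mathbb{N}\to\mathbb{C}$ be an arithmetic function and define $b(n):=\sum_{d\mid n}a(d)\mu(n/d)$, where $\mu$ is the Möbius function. Let $f$ be continuous on $\mathbb{R}$ with $f\in L_1(\mathbb{R})$, such that $\sum_{n\in\mathbb{Z},\,n\neq 0}a(n)f(n)$ converges absolutely, and such that $f(x)=O(x^{-m})$ for some $m>1$ as $x\to\infty$, so that its Mellin transform $\mathfrak{M}(f)(s)=\int_0^\infty x^{s-1}f(x)\,dx$ exists. Let $\mathscr{F}(f)(w)=\int_0^\infty \cos(2\pi w x)f(x)\,dx$ be the Fourier cosine transform of $f$, and let $\zeta$ denote the Riemann zeta function. Then, assuming absolute convergence of the series involved, $$\sum_{n\ge1}a(n)\mathscr{F}(f)(n)=\frac{1}{2}\sum_{m\ge1}\frac{b(m)}{m}\left(\mathfrak{M}^{-1}\left(\zeta(s)\mathfrak{M}(f)(s)\right)(1/m)+\frac{f(0)}{2}\right),$$ where $\mathfrak{M}^{-1}\left(\zeta(s)\mathfrak{M}(f)(s)\right)(1/m)=\frac{1}{2\pi i}\int_{c-i\infty}^{c+i\infty}m^{s}\zeta(s)\mathfrak{M}(f)(s)\,ds$ is taken over a vertical line $\Re(s)=c$ with $0<c<1$.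
   Context: $\mathfrak{M}^{-1}$ denotes the inverse Mellin transform: for a function $F(s)$ analytic on the line $\Re(s)=c$, $\mathfrak{M}^{-1}(F)(x)=\frac{1}{2\pi i}\int_{c-i\infty}^{c+i\infty}x^{-s}F(s)\,ds$.
   Formalization: "Absolute convergence of the series involved" is taken to include the double series of b(m)F(f)(mk) over m,k≥1 (with only the two displayed series the claim can fail); the inverse Mellin integrals at 1/m are assumed to converge as symmetric limits. *)

theory Defs
  imports
    "HOL-Complex_Analysis.Complex_Analysis"
    "HOL-Computational_Algebra.Squarefree"
begin

definition moebius_mu :: "nat \<Rightarrow> int" where
  "moebius_mu n = (if squarefree n then (- 1) ^ card (prime_factors n) else 0)"

definition is_zeta :: "(complex \<Rightarrow> complex) \<Rightarrow> bool" where
  "is_zeta Z \<longleftrightarrow> Z holomorphic_on (- {1}) \<and>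
     (\<forall>s. Re s > 1 \<longrightarrow> Z s = (\<Sum>n. of_nat (Suc n) powr (- s)))"

text \<open>The two conditions determine the function away from its pole, see the lemmas
  \<open>is_zeta_zeta\<close> and \<open>is_zeta_unique\<close> below; the value at \<open>1\<close> is irrelevant.\<close>
definition zeta :: "complex \<Rightarrow> complex" where
  "zeta = (SOME Z. is_zeta Z)"

definition mellin :: "(real \<Rightarrow> complex) \<Rightarrow> complex \<Rightarrow> complex" where
  "mellin f s = (LINT x:{0<..}|lborel. of_real x powr (s - 1) * f x)"

definition fourier_cos :: "(real \<Rightarrow> complex) \<Rightarrow> real \<Rightarrow> complex" where
  "fourier_cos f w = (LINT x:{0..}|lborel. of_real (cos (2 * pi * w * x)) * f x)"

text \<open>The integral over the line \<open>Re s = c\<close> is the limit of the integrals over the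
  segments from \<open>c - iT\<close> to \<open>c + iT\<close>; it need not converge absolutely.\<close>
definition has_inverse_mellin ::
    "real \<Rightarrow> (complex \<Rightarrow> complex) \<Rightarrow> real \<Rightarrow> complex \<Rightarrow> bool" where
  "has_inverse_mellin c F x L \<longleftrightarrow>
     ((\<lambda>T. 1 / (2 * of_real pi * \<i>) *
        contour_integral (linepath (Complex c (- T)) (Complex c T))
          (\<lambda>s. of_real x powr (- s) * F s)) \<longlongrightarrow> L) at_top"

definition inverse_mellin ::
    "real \<Rightarrow> (complex \<Rightarrow> complex) \<Rightarrow> real \<Rightarrow> complex" where
  "inverse_mellin c F x = (THE L. has_inverse_mellin c F x L)"

lemma inverse_mellin_eqI: "has_inverse_mellin c F x L \<Longrightarrow> inverse_mellin c F x = L"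
  unfolding inverse_mellin_def
  by (rule the_equality)
     (auto simp: has_inverse_mellin_def intro: tendsto_unique[OF trivial_limit_at_top_linorder])

lemma zeta_series_bound:
  fixes s :: complex
  shows "norm (of_nat (Suc n) powr (- s)) = real (Suc n) powr (- Re s)"
  by (subst norm_powr_real_powr, rule Reals_of_nat)
     (simp_all only: complex_Re_of_nat uminus_complex.sel of_nat_0_le_iff)

lemma summable_Suc_powr: "\<sigma> > 1 \<Longrightarrow> summable (\<lambda>n. real (Suc n) powr (- \<sigma>))"
  using summable_real_powr_iff[of "-\<sigma>"] by (subst summable_Suc_iff) simp

lemma holomorphic_Re_series:
  fixes g :: "nat \<Rightarrow> complex \<Rightarrow> complex" and C :: "complex \<Rightarrow> real"
  assumes hol: "\<And>n. g n holomorphic_on {s. Re s > \<sigma>}"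
    and C: "continuous_on UNIV C"
    and bd: "\<And>n s. Re s > \<sigma> \<Longrightarrow> norm (g n s) \<le> C s * real (Suc n) powr (- (Re s + 1 - \<sigma>))"
  shows "(\<lambda>s. \<Sum>n. g n s) holomorphic_on {s. Re s > \<sigma>}"
    and "Re s > \<sigma> \<Longrightarrow> summable (\<lambda>n. g n s)"
proof -
  let ?S = "{s. Re s > \<sigma>}"
  have op: "open ?S" by (simp add: open_halfspace_Re_gt)
  have "\<exists>G G'. \<forall>x\<in>?S. (\<lambda>n. g n x) sums G x \<and> (\<lambda>n. deriv (g n) x) sums G' x
           \<and> (G has_field_derivative G' x) (at x)"
  proof (rule series_and_derivative_comparison_local[OF op])
    fix n x assume "x \<in> ?S"
    then show "(g n has_field_derivative deriv (g n) x) (at x)"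
      using hol op holomorphic_derivI by blast
  next
    fix x assume x: "x \<in> ?S"
    define d where "d = (Re x - \<sigma>) / 2"
    have d: "d > 0" using x by (simp add: d_def)
    have "compact (C ` cball x d)"
      by (intro compact_continuous_image continuous_on_subset[OF C]) auto
    then obtain B where B: "\<And>y. y \<in> cball x d \<Longrightarrow> norm (C y) \<le> B"
      using compact_imp_bounded bounded_iff by (metis imageI)
    have "norm (g n y) \<le> B * real (Suc n) powr (- (1 + d))" if y: "y \<in> ball x d \<inter> ?S" for n y
    proof -
      have "\<bar>Re (x - y)\<bar> \<le> d" using y abs_Re_le_cmod[of "x - y"] by (simp add: dist_norm)
      hence le: "- (Re y + 1 - \<sigma>) \<le> - (1 + d)" by (simp add: d_def field_simps abs_if split: if_splits)
      have "norm (g n y) \<le> C y * real (Suc n) powr (- (Re y + 1 - \<sigma>))" using bd y by simp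
      also have "\<dots> \<le> B * real (Suc n) powr (- (Re y + 1 - \<sigma>))"
        using B[of y] y by (intro mult_right_mono) auto
      also have "\<dots> \<le> B * real (Suc n) powr (- (1 + d))"
        using B[of y] y le by (intro mult_left_mono powr_mono) (auto intro: order_trans[OF norm_ge_zero])
      finally show ?thesis .
    qed
    moreover have "summable (\<lambda>n. B * real (Suc n) powr (- (1 + d)))"
      by (intro summable_mult summable_Suc_powr) (use d in auto)
    ultimately show "\<exists>d h. 0 < d \<and> summable h \<and>
        (\<forall>\<^sub>F n in sequentially. \<forall>y\<in>ball x d \<inter> ?S. norm (g n y) \<le> h n)"
      using d by (intro exI[of _ d] exI[of _ "\<lambda>n. B * real (Suc n) powr (- (1 + d))"]) auto
  qed
  then obtain G G' where G: "\<And>x. x \<in> ?S \<Longrightarrow> (\<lambda>n. g n x) sums G x"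
      "\<And>x. x \<in> ?S \<Longrightarrow> (G has_field_derivative G' x) (at x)" by blast
  have "G holomorphic_on ?S"
    using G(2) op by (auto simp: holomorphic_on_open)
  then show "(\<lambda>s. \<Sum>n. g n s) holomorphic_on ?S"
    by (rule holomorphic_transform) (use G(1) in \<open>auto simp: sums_iff\<close>)
  show "summable (\<lambda>n. g n s)" if "Re s > \<sigma>" using G(1)[of s] that by (auto simp: sums_iff)
qed

text \<open>The remainder of order \<open>N\<close> in the Taylor expansion of \<open>x \<mapsto> x powr (1 - s)\<close>
  from \<open>n + 1\<close> to \<open>n + 2\<close>. Summing the expansion over \<open>n\<close> expresses \<open>(s - 1) \<zeta>(s)\<close> through
  \<open>\<zeta>(s + 1), \<dots>, \<zeta>(s + N - 1)\<close>, which continues it one unit further to the left.\<close>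
definition zeta_rem :: "nat \<Rightarrow> nat \<Rightarrow> complex \<Rightarrow> complex" where
  "zeta_rem N n s = of_nat (Suc (Suc n)) powr (1 - s)
     - (\<Sum>k\<le>N. (- 1) ^ k * pochhammer (s - 1) k / fact k * of_nat (Suc n) powr (1 - s - of_nat k))"

lemma zeta_rem_bound:
  assumes s: "Re s > 1 - real N"
  shows "norm (zeta_rem N n s) \<le>
     norm (pochhammer (s - 1) (Suc N)) / fact N * real (Suc n) powr (- (Re s + 1 - (1 - real N)))"
proof -
  let ?x = "of_nat (Suc n) :: complex" and ?y = "of_nat (Suc (Suc n)) :: complex"
  define F where "F = (\<lambda>k z. (- 1) ^ k * pochhammer (s - 1) k * z powr (1 - s - of_nat k) :: complex)"
  let ?S = "closed_segment ?x ?y"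
  have seg: "\<exists>t. z = of_real t \<and> t \<ge> real (Suc n)" if "z \<in> ?S" for z
  proof -
    have "z \<in> of_real ` closed_segment (real (Suc n)) (real (Suc (Suc n)))"
      using that closed_segment_of_real[of "real (Suc n)" "real (Suc (Suc n))", where 'a = complex] by simp
    then show ?thesis by (auto simp: closed_segment_eq_real_ivl)
  qed
  let ?B = "norm (pochhammer (s - 1) (Suc N)) * real (Suc n) powr (- (Re s + real N))"
  have "norm (F 0 ?y - (\<Sum>i\<le>N. F i ?x * (?y - ?x) ^ i / fact i)) \<le> ?B * norm (?y - ?x) ^ Suc N / fact N"
  proof (rule complex_Taylor[of ?S])
    fix i z assume z: "z \<in> ?S"
    then obtain t where t: "z = of_real t" "t \<ge> real (Suc n)" using seg by blast
    then have "z \<notin> \<real>\<^sub>\<le>\<^sub>0" by auto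
    then have "((\<lambda>z. (- 1) ^ i * pochhammer (s - 1) i * z powr (1 - s - of_nat i)) has_field_derivative
       (- 1) ^ i * pochhammer (s - 1) i * ((1 - s - of_nat i) * z powr (1 - s - of_nat i - 1))) (at z within ?S)"
      by (intro DERIV_cmult has_field_derivative_at_within[OF has_field_derivative_powr])
    moreover have "(- 1) ^ i * pochhammer (s - 1) i * ((1 - s - of_nat i) * z powr (1 - s - of_nat i - 1)) = F (Suc i) z"
      by (simp add: F_def pochhammer_Suc algebra_simps)
    ultimately show "(F i has_field_derivative F (Suc i) z) (at z within ?S)"
      by (simp add: F_def)
  next
    fix z assume z: "z \<in> ?S"
    then obtain t where t: "z = of_real t" "t \<ge> real (Suc n)" using seg by blast
    have "norm (z powr (1 - s - of_nat (Suc N))) = t powr (- (Re s + real N))"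
      using t by (simp add: norm_powr_real_powr algebra_simps)
    also have "\<dots> \<le> real (Suc n) powr (- (Re s + real N))"
      using t s by (intro powr_mono2') auto
    finally show "norm (F (Suc N) z) \<le> ?B"
      by (simp add: F_def norm_mult norm_power mult_left_mono)
  qed auto
  then show ?thesis
    by (simp add: F_def zeta_rem_def field_simps)
qed


lemma zeta_rem_series:
  shows "(\<lambda>s. \<Sum>n. zeta_rem N n s) holomorphic_on {s. Re s > 1 - real N}"
    and "Re s > 1 - real N \<Longrightarrow> summable (\<lambda>n. zeta_rem N n s)"
proof -
  have 1: "zeta_rem N n holomorphic_on {s. Re s > 1 - real N}" for n
    unfolding zeta_rem_def pochhammer_prod
    by (intro holomorphic_intros) (auto simp del: of_nat_Suc)
  have 2: "continuous_on UNIV (\<lambda>s::complex. norm (pochhammer (s - 1) (Suc N)) / fact N)"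
    unfolding pochhammer_prod by (intro continuous_intros) auto
  show "(\<lambda>s. \<Sum>n. zeta_rem N n s) holomorphic_on {s. Re s > 1 - real N}"
    and "Re s > 1 - real N \<Longrightarrow> summable (\<lambda>n. zeta_rem N n s)"
    using holomorphic_Re_series[of "zeta_rem N" "1 - real N", OF 1 2] zeta_rem_bound by auto
qed

lemma zeta_series:
  shows "(\<lambda>s. \<Sum>n. of_nat (Suc n) powr (- s)) holomorphic_on {s. Re s > 1}"
    and "Re s > 1 \<Longrightarrow> summable (\<lambda>n. of_nat (Suc n) powr (- s) :: complex)"
proof -
  have 1: "(\<lambda>s. of_nat (Suc n) powr (- s)) holomorphic_on {s. Re s > 1}" for n
    by (intro holomorphic_intros) (auto simp del: of_nat_Suc)
  have 2: "continuous_on UNIV (\<lambda>s::complex. 1 :: real)" by simp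
  show "(\<lambda>s. \<Sum>n. of_nat (Suc n) powr (- s)) holomorphic_on {s. Re s > 1}"
    and "Re s > 1 \<Longrightarrow> summable (\<lambda>n. of_nat (Suc n) powr (- s) :: complex)"
    using holomorphic_Re_series[of "\<lambda>n s. of_nat (Suc n) powr (- s)" 1, OF 1 2] zeta_series_bound
    by (auto simp del: of_nat_Suc)
qed

lemma zeta_recursion:
  assumes s: "Re s > 1" and N: "N \<ge> 1"
  defines "Z \<equiv> \<lambda>s::complex. \<Sum>n. of_nat (Suc n) powr (- s)"
  shows "(s - 1) * Z s = 1 + (\<Sum>k=2..N. (- 1) ^ k * pochhammer (s - 1) (k - 1) / fact k *
           ((s + of_nat k - 2) * Z (s + of_nat k - 1))) + (\<Sum>n. zeta_rem N n s)"
proof -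
  define c where "c = (\<lambda>k. (- 1) ^ k * pochhammer (s - 1) k / fact k :: complex)"
  have lim: "(\<lambda>n. of_nat (Suc n) powr (1 - s) :: complex) \<longlonglongrightarrow> 0"
  proof (rule tendsto_norm_zero_cancel)
    have "(\<lambda>n. real n powr (- (Re s - 1))) \<longlonglongrightarrow> 0"
      by (rule tendsto_neg_powr) (use s in \<open>auto intro: filterlim_real_sequentially\<close>)
    then have "(\<lambda>n. real (Suc n) powr (- (Re s - 1))) \<longlonglongrightarrow> 0"
      by (rule LIMSEQ_Suc)
    then show "(\<lambda>n. norm (of_nat (Suc n) powr (1 - s) :: complex)) \<longlonglongrightarrow> 0"
      using zeta_series_bound[of _ "s - 1"] by (simp del: of_nat_Suc)
  qed
  have "(\<lambda>n. of_nat (Suc n) powr (1 - s) - of_nat (Suc (Suc n)) powr (1 - s) :: complex) sums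
          (of_nat (Suc 0) powr (1 - s) - 0)"
    by (rule telescope_sums'[OF lim])
  moreover have "(\<lambda>n. - (\<Sum>k=1..N. c k * of_nat (Suc n) powr (- (s + of_nat k - 1))) - zeta_rem N n s) sums
          (- (\<Sum>k=1..N. c k * Z (s + of_nat k - 1)) - (\<Sum>n. zeta_rem N n s))"
  proof (intro sums_diff sums_minus sums_sum sums_mult)
    fix k assume "k \<in> {1..N}"
    then show "(\<lambda>n. of_nat (Suc n) powr (- (s + of_nat k - 1))) sums Z (s + of_nat k - 1)"
      unfolding Z_def by (intro summable_sums zeta_series(2)) (use s in auto)
  next
    show "(\<lambda>n. zeta_rem N n s) sums (\<Sum>n. zeta_rem N n s)"
      by (intro summable_sums zeta_rem_series(2)) (use s in linarith)
  qed
  moreover have "of_nat (Suc n) powr (1 - s) - of_nat (Suc (Suc n)) powr (1 - s) =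
      - (\<Sum>k=1..N. c k * of_nat (Suc n) powr (- (s + of_nat k - 1))) - zeta_rem N n s" for n
  proof -
    have "{..N} = insert 0 {1..N}" by auto
    then have "(\<Sum>k\<le>N. c k * of_nat (Suc n) powr (1 - s - of_nat k)) =
       of_nat (Suc n) powr (1 - s) + (\<Sum>k=1..N. c k * of_nat (Suc n) powr (1 - s - of_nat k))"
      by (simp add: c_def del: of_nat_Suc)
    moreover have "- (s + of_nat k - 1) = 1 - s - of_nat k" for k by simp
    moreover have "zeta_rem N n s = of_nat (Suc (Suc n)) powr (1 - s)
        - (\<Sum>k\<le>N. c k * of_nat (Suc n) powr (1 - s - of_nat k))"
      by (simp only: zeta_rem_def c_def)
    ultimately show ?thesis by (simp only:) simp
  qed
  ultimately have e1: "1 = - (\<Sum>k=1..N. c k * Z (s + of_nat k - 1)) - (\<Sum>n. zeta_rem N n s)"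
    by (simp add: sums_unique2)
  have "{1..N} = insert 1 {2..N}" using N by auto
  then have e2: "(\<Sum>k=1..N. c k * Z (s + of_nat k - 1)) =
     - ((s - 1) * Z s) + (\<Sum>k=2..N. c k * Z (s + of_nat k - 1))"
    by (simp add: c_def left_diff_distrib)
  have e3: "(\<Sum>k=2..N. c k * Z (s + of_nat k - 1)) =
      (\<Sum>k=2..N. (- 1) ^ k * pochhammer (s - 1) (k - 1) / fact k * ((s + of_nat k - 2) * Z (s + of_nat k - 1)))"
  proof (rule sum.cong)
    fix k assume k: "k \<in> {2..N}"
    then obtain j where j: "k = Suc j" by (cases k) auto
    show "c k * Z (s + of_nat k - 1) =
      (- 1) ^ k * pochhammer (s - 1) (k - 1) / fact k * ((s + of_nat k - 2) * Z (s + of_nat k - 1))"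
    proof -
      have "s + of_nat k - 2 = s - 1 + of_nat j" by (simp add: j)
      moreover have "pochhammer (s - 1) k = pochhammer (s - 1) (k - 1) * (s - 1 + of_nat j)"
        by (simp add: j pochhammer_Suc)
      ultimately show ?thesis unfolding c_def by simp
    qed
  qed simp
  have "A = 1 + B' + R" if "1 = - X - R" "X = - A + B" "B = B'" for A B B' R X :: complex
    using that by (simp add: algebra_simps)
  from this[OF e1 e2 e3] show ?thesis .
qed

lemma zeta_continuation_halfplane:
  "\<exists>K. K holomorphic_on {s. Re s > 1 - real M} \<and>
     (\<forall>s. Re s > 1 \<longrightarrow> K s = (s - 1) * (\<Sum>n. of_nat (Suc n) powr (- s)))"
proof (induction M)
  case 0
  show ?case
    by (rule exI[of _ "\<lambda>s. (s - 1) * (\<Sum>n. of_nat (Suc n) powr (- s))"])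
       (auto intro!: holomorphic_on_mult holomorphic_on_diff zeta_series(1) simp del: of_nat_Suc)
next
  case (Suc M)
  then obtain K where K: "K holomorphic_on {s. Re s > 1 - real M}"
      "\<And>s. Re s > 1 \<Longrightarrow> K s = (s - 1) * (\<Sum>n. of_nat (Suc n) powr (- s))" by blast
  define L where "L = (\<lambda>s. 1 + (\<Sum>k=2..Suc M. (- 1) ^ k * pochhammer (s - 1) (k - 1) / fact k *
           K (s + of_nat k - 1)) + (\<Sum>n. zeta_rem (Suc M) n s))"
  have K': "(\<lambda>s. K (s + of_nat k - 1)) holomorphic_on {s. Re s > 1 - real (Suc M)}" if "k \<ge> 2" for k
    by (rule holomorphic_on_compose_gen[OF _ K(1), unfolded o_def])
       (use that in \<open>auto intro!: holomorphic_intros\<close>)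
  have "L holomorphic_on {s. Re s > 1 - real (Suc M)}"
    unfolding L_def pochhammer_prod
    by (intro holomorphic_intros zeta_rem_series(1) K') auto
  moreover have "L s = (s - 1) * (\<Sum>n. of_nat (Suc n) powr (- s))" if s: "Re s > 1" for s
  proof -
    have "K (s + of_nat k - 1) = (s + of_nat k - 2) * (\<Sum>n. of_nat (Suc n) powr (- (s + of_nat k - 1)))"
      if "k \<in> {2..Suc M}" for k
      by (subst K(2)) (use that s in \<open>auto simp: algebra_simps\<close>)
    then show ?thesis
      unfolding L_def by (subst zeta_recursion[OF s, of "Suc M"]) (simp_all del: of_nat_Suc)
  qed
  ultimately show ?case by blast
qed

lemma is_zeta_exists: "\<exists>Z. is_zeta Z"
proof -
  let ?H = "\<lambda>M::nat. {s::complex. Re s > 1 - real M}"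
  obtain K where K: "\<And>M. K M holomorphic_on ?H M"
      "\<And>M s. Re s > 1 \<Longrightarrow> K M s = (s - 1) * (\<Sum>n. of_nat (Suc n) powr (- s))"
    using zeta_continuation_halfplane by metis
  have mono: "K M s = K M' s" if "M \<le> M'" "s \<in> ?H M" for M M' s
  proof (rule analytic_continuation_open[of "?H 0" "?H M" "K M" "K M'"])
    show "open (?H 0)" "open (?H M)" by (simp_all add: open_halfspace_Re_gt)
    show "connected (?H M)" by (intro convex_connected convex_halfspace_Re_gt)
    show "?H 0 \<noteq> {}" by (auto intro: exI[of _ 2])
    show "K M' holomorphic_on ?H M"
      by (rule holomorphic_on_subset[OF K(1)[of M']]) (use that in auto)
    show "K M z = K M' z" if "z \<in> ?H 0" for z
      using that K(2)[of z M] K(2)[of z M'] by simp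
    show "?H 0 \<subseteq> ?H M" by auto
  qed (fact K(1), fact that(2))
  have eq: "K M s = K M' s" if "s \<in> ?H M" "s \<in> ?H M'" for M M' s
  proof (cases "M \<le> M'")
    case True
    then show ?thesis using that(1) by (rule mono)
  next
    case False
    then have "M' \<le> M" by simp
    then show ?thesis using that(2) by (rule mono[symmetric])
  qed
  define m where "m = (\<lambda>s::complex. nat \<lceil>2 - Re s\<rceil>)"
  have m: "s \<in> ?H (m s)" for s
  proof -
    have "2 - Re s \<le> real (m s)" unfolding m_def by (rule real_nat_ceiling_ge)
    then show ?thesis by simp
  qed
  define F where "F = (\<lambda>s. K (m s) s)"
  have F: "F s = K M s" if "s \<in> ?H M" for M s
    unfolding F_def using eq[OF m that] .
  have F_hol: "F holomorphic_on UNIV"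
  proof -
    have "F holomorphic_on (\<Union>M. ?H M)"
    proof (rule holomorphic_on_UN_open)
      show "F holomorphic_on ?H M" for M
        by (rule holomorphic_transform[OF K(1)[of M]]) (rule F[symmetric])
      show "open (?H M)" for M by (simp add: open_halfspace_Re_gt)
    qed
    moreover have "(\<Union>M. ?H M) = UNIV" using m by blast
    ultimately show ?thesis by simp
  qed
  have "(\<lambda>s. F s / (s - 1)) holomorphic_on (- {1})"
    by (intro holomorphic_on_divide holomorphic_on_diff holomorphic_on_ident holomorphic_on_const
          holomorphic_on_subset[OF F_hol]) auto
  moreover have "F s / (s - 1) = (\<Sum>n. of_nat (Suc n) powr (- s))" if "Re s > 1" for s
  proof -
    have "F s = (s - 1) * (\<Sum>n. of_nat (Suc n) powr (- s))"
      unfolding K(2)[OF that, of 0, symmetric] by (rule F) (use that in simp)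
    moreover have "s \<noteq> 1" using that by auto
    ultimately show ?thesis by (simp only:) simp
  qed
  ultimately show ?thesis unfolding is_zeta_def by blast
qed

lemma is_zeta_zeta: "is_zeta zeta"
  unfolding zeta_def using is_zeta_exists by (rule someI_ex)

lemma is_zeta_unique:
  assumes "is_zeta Z" "s \<noteq> 1"
  shows "Z s = zeta s"
proof (rule analytic_continuation_open[of "{s. Re s > 1}" "- {1}" Z zeta])
  show "open {s. Re s > 1}" by (simp add: open_halfspace_Re_gt)
  show "{s. Re s > 1} \<noteq> {}" by (auto intro: exI[of _ 2])
  show "connected (- {1 :: complex})" by (rule connected_punctured_universe) simp
qed (use assms is_zeta_zeta in \<open>auto simp: is_zeta_def\<close>)

end

theory Submission
  imports Defs "HOL-Probability.Probability"
begin

text \<open>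
  By Moebius inversion \<open>a(n)\<close> is the sum of \<open>b(m)\<close> over \<open>m | n\<close>, so the left-hand side
  is the sum of \<open>b(m) F(m k)\<close> over \<open>m, k \<ge> 1\<close>, with \<open>F\<close> the cosine transform of \<open>f\<close>. Poisson summation
  for the even function \<open>x \<mapsto> f(|x| / m)\<close> evaluates the inner sum as
  \<open>1 / (2 m)\<close> times \<open>f(0) / 2 + (\<Sum>n\<ge>1. f(n / m)) - m \<integral> f\<close>, the integral being over \<open>(0, \<infinity>)\<close>, and the
  Muentz formula identifies \<open>(\<Sum>n\<ge>1. f(n / m)) - m \<integral> f\<close> with the inverse Mellin transform of
  \<open>\<zeta>(s) \<M>(f)(s)\<close> at \<open>1 / m\<close>.

  As \<open>f\<close> is merely continuous, both formulas need a summability method. For Poisson summation this is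
  Abel summation: the cosine series is absolutely convergent, and the Poisson kernel is an
  approximate identity. For the Muentz formula, the principal value along \<open>Re s = c\<close> is the limit of
  integrals with Gaussian weights \<open>exp (- (t / R)\<^sup>2 / 2)\<close>. Under the weight one may replace \<open>\<zeta>(s)\<close> by
  \<open>(\<Sum>n\<le>N. n\<^sup>-\<^sup>s) - (N + 1)\<^sup>1\<^sup>-\<^sup>s / (1 - s)\<close>, which tends to \<open>\<zeta>(s)\<close> for \<open>Re s > 0\<close> and grows at most
  linearly in \<open>t\<close>; the weighted inverse transform of \<open>\<M>(f)\<close> is an average of \<open>f\<close> over a log-normal
  distribution concentrating at the given point, and no contour has to be shifted.
\<close>

section \<open>Moebius inversion\<close>

text \<open>Only squarefree divisors contribute, and taking prime factors matches them with the
  subsets of \<open>prime_factors n\<close>. The signed count of these subsets is the expansion of a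
  product of factors \<open>(- 1) + 1\<close>, which is empty exactly for
  \<open>n = 1\<close>.\<close>

lemma sum_moebius_mu_divisors:
  assumes n: "n > 0"
  shows "(\<Sum>d | d dvd n. moebius_mu d) = (if n = 1 then 1 else 0)"
proof -
  let ?P = "prime_factors n"
  have pf: "prime_factors (\<Prod>A) = A" if A: "A \<subseteq> ?P" for A
  proof -
    have "finite A" using A finite_subset by blast
    moreover have pr: "\<And>p. p \<in> A \<Longrightarrow> prime p" using A by auto
    moreover have "0 \<notin> id ` A" using pr by fastforce
    ultimately have "prime_factors (prod id A) = \<Union>((prime_factors \<circ> id) ` A)"
      by (intro prime_factors_prod)
    also have "\<dots> = A" using pr by (auto simp: prime_prime_factors)
    finally show ?thesis by simp
  qed
  have sq: "squarefree (\<Prod>A)" if A: "A \<subseteq> ?P" for A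
  proof -
    have pr: "\<And>p. p \<in> A \<Longrightarrow> prime p" using A by auto
    have "squarefree (prod id A)"
      by (rule squarefree_prod_coprime) (auto simp: primes_coprime pr squarefree_prime)
    then show ?thesis by simp
  qed
  have dv: "\<Prod>A dvd n" if A: "A \<subseteq> ?P" for A
  proof -
    have "\<Prod>A dvd \<Prod>?P" by (rule prod_dvd_prod_subset) (use A in auto)
    also have "\<dots> dvd (\<Prod>p\<in>?P. p ^ multiplicity p n)"
      by (rule prod_dvd_prod) (auto intro!: dvd_power simp: prime_factors_multiplicity)
    also have "\<dots> = n" using n by (simp add: prod_prime_factors)
    finally show ?thesis .
  qed
  have "(\<Sum>d | d dvd n. moebius_mu d) = (\<Sum>d | d dvd n \<and> squarefree d. moebius_mu d)"
    by (rule sum.mono_neutral_right) (use n in \<open>auto simp: moebius_mu_def\<close>)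
  also have "\<dots> = (\<Sum>A\<in>Pow ?P. (-1) ^ card A)"
  proof (rule sum.reindex_bij_witness[of _ "\<lambda>A. \<Prod>A" prime_factors])
    fix d assume d: "d \<in> {d. d dvd n \<and> squarefree d}"
    then have d0: "d \<noteq> 0" using n by auto
    have "\<Prod>(prime_factors d) = (\<Prod>p\<in>prime_factors d. p ^ multiplicity p d)"
      by (rule prod.cong) (use d d0 squarefree_factorial_semiring'[of d] in auto)
    also have "\<dots> = d" using d0 by (simp add: prod_prime_factors)
    finally show "\<Prod>(prime_factors d) = d" .
    show "prime_factors d \<in> Pow ?P" using d n by (auto simp: dvd_prime_factors intro: dvd_trans)
    show "(- 1) ^ card (prime_factors d) = moebius_mu d" using d by (simp add: moebius_mu_def)
  qed (use pf sq dv in auto)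
  also have "\<dots> = (\<Prod>p\<in>?P. (- 1) + 1)"
    by (subst prod_add) auto
  also have "\<dots> = (if n = 1 then 1 else 0)"
    using n by (auto simp: prime_factorization_empty_iff card_gt_0_iff)
  finally show ?thesis .
qed

text \<open>Exchanging the sums and writing \<open>m = d * e\<close> leaves an inner sum of
  \<open>moebius_mu\<close> over the divisors of \<open>n div d\<close>, which vanishes unless
  \<open>d = n\<close>.\<close>

lemma moebius_inversion:
  fixes a b :: "nat \<Rightarrow> 'a::comm_ring_1"
  assumes b: "\<And>n. n \<ge> 1 \<Longrightarrow> b n = (\<Sum>d | d dvd n. a d * of_int (moebius_mu (n div d)))"
    and n: "n \<ge> 1"
  shows "(\<Sum>m | m dvd n. b m) = a n"
proof -
  have nz: "m \<noteq> 0" if "m dvd n" for m using that n by auto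
  have "(\<Sum>m | m dvd n. b m) =
        (\<Sum>m | m dvd n. \<Sum>d | d dvd m. a d * of_int (moebius_mu (m div d)))"
    by (rule sum.cong) (use b nz in \<open>auto simp: Suc_le_eq\<close>)
  also have "\<dots> = (\<Sum>(m, d)\<in>(SIGMA m:{m. m dvd n}. {d. d dvd m}). a d * of_int (moebius_mu (m div d)))"
    by (rule sum.Sigma) (use n nz in auto)
  also have "\<dots> = (\<Sum>(d, e)\<in>(SIGMA d:{d. d dvd n}. {e. e dvd n div d}). a d * of_int (moebius_mu e))"
    by (rule sum.reindex_bij_witness[of _ "\<lambda>(d, e). (d * e, d)" "\<lambda>(m, d). (d, m div d)"])
       (use n in \<open>auto simp: dvd_div_iff_mult div_dvd_iff_mult elim!: dvdE\<close>)
  also have "\<dots> = (\<Sum>d | d dvd n. a d * of_int (\<Sum>e | e dvd n div d. moebius_mu e))"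
    by (subst sum.Sigma[symmetric])
       (use n in \<open>auto simp: sum_distrib_left dvd_div_eq_0_iff intro!: finite_divisors_nat Nat.gr0I\<close>)
  also have "\<dots> = (\<Sum>d | d dvd n. if d = n then a d else 0)"
  proof (rule sum.cong)
    fix d assume d: "d \<in> {d. d dvd n}"
    then have pos: "n div d > 0" using n by (auto elim!: dvdE)
    have "n div d = 1 \<longleftrightarrow> d = n" using d n by (auto elim!: dvdE)
    then show "a d * of_int (\<Sum>e | e dvd n div d. moebius_mu e) = (if d = n then a d else 0)"
      unfolding sum_moebius_mu_divisors[OF pos] by simp
  qed simp
  also have "\<dots> = a n" using n by (simp add: sum.delta)
  finally show ?thesis .
qed

text \<open>Pairs \<open>(m, k)\<close> correspond to pairs \<open>(n, m)\<close> with
  \<open>m dvd n\<close> through \<open>n = m * k\<close>; absolute summability over the pairs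
  permits summation in either order.\<close>

lemma infsum_divisor_sum:
  fixes b F :: "nat \<Rightarrow> complex"
  assumes "(\<lambda>(m, k). norm (b m * F (m * k))) summable_on ({1..} \<times> {1..})"
  shows "(\<Sum>\<^sub>\<infinity>n\<in>{1..}. (\<Sum>m | m dvd n. b m) * F n) =
         (\<Sum>\<^sub>\<infinity>m\<in>{1..}. b m * (\<Sum>\<^sub>\<infinity>k\<in>{1..}. F (m * k)))"
proof -
  let ?g = "\<lambda>(m, k). b m * F (m * k)"
  let ?S = "Sigma {1..} (\<lambda>n::nat. {m. m dvd n})"
  have bij: "bij_betw (\<lambda>(m, k). (m * k, m)) ({1..} \<times> {1..}) ?S"
    by (rule bij_betw_byWitness[where f' = "\<lambda>(n, m). (m, n div m)"])
       (auto simp: Suc_le_eq elim!: dvdE)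
  have sg: "?g summable_on ({1..} \<times> {1..})"
    by (rule abs_summable_summable) (use assms in \<open>simp add: case_prod_unfold\<close>)
  have eq: "(\<lambda>x. (\<lambda>(n, m). b m * F n) ((\<lambda>(m, k). (m * k, m)) x)) = ?g" by auto
  have sS: "(\<lambda>(n, m). b m * F n) summable_on ?S"
    using summable_on_reindex_bij_betw[OF bij, of "\<lambda>(n, m). b m * F n"] sg
    unfolding eq by simp
  have "(\<Sum>\<^sub>\<infinity>n\<in>{1..}. (\<Sum>m | m dvd n. b m) * F n) =
        (\<Sum>\<^sub>\<infinity>n\<in>{1..}. \<Sum>\<^sub>\<infinity>m\<in>{m. m dvd n}. b m * F n)"
    by (rule infsum_cong) (auto simp: sum_distrib_right Suc_le_eq)
  also have "\<dots> = infsum (\<lambda>(n, m). b m * F n) ?S"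
    by (rule infsum_Sigma'_banach[OF sS])
  also have "\<dots> = infsum ?g ({1..} \<times> {1..})"
    using infsum_reindex_bij_betw[OF bij, of "\<lambda>(n, m). b m * F n"] unfolding eq by simp
  also have "\<dots> = (\<Sum>\<^sub>\<infinity>m\<in>{1..}. \<Sum>\<^sub>\<infinity>k\<in>{1..}. b m * F (m * k))"
    by (rule infsum_Sigma'_banach[OF sg, symmetric])
  also have "\<dots> = (\<Sum>\<^sub>\<infinity>m\<in>{1..}. b m * (\<Sum>\<^sub>\<infinity>k\<in>{1..}. F (m * k)))"
    by (simp add: infsum_cmult_right')
  finally show ?thesis .
qed

section \<open>Poisson summation on the half-line\<close>

text \<open>For \<open>0 \<le> r < 1\<close> this is the closed form of
  \<open>1 + 2 * (\<Sum>k\<ge>1. r ^ k * cos (2 * pi * k * t))\<close>, scaled to period 1. The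
  closed form shows positivity, which the series hides.\<close>

definition poisson_kernel :: "real \<Rightarrow> real \<Rightarrow> real" where
  "poisson_kernel r t = (1 - r\<^sup>2) / (1 - 2 * r * cos (2 * pi * t) + r\<^sup>2)"

lemma poisson_kernel_denominator_pos:
  fixes r x :: real
  assumes "0 \<le> r" "r < 1"
  shows "1 - 2 * r * cos x + r\<^sup>2 > 0"
proof -
  have "0 < (1 - r)\<^sup>2" using assms by (intro zero_less_power) simp
  also have "\<dots> \<le> (1 - r)\<^sup>2 + 2 * r * (1 - cos x)" using assms by simp
  also have "\<dots> = 1 - 2 * r * cos x + r\<^sup>2" by (simp add: power2_eq_square algebra_simps)
  finally show ?thesis .
qed

lemma poisson_kernel_nonneg: "0 \<le> r \<Longrightarrow> r < 1 \<Longrightarrow> 0 \<le> poisson_kernel r t"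
  unfolding poisson_kernel_def
  by (intro divide_nonneg_pos poisson_kernel_denominator_pos) (auto simp: power_le_one)

text \<open>This is the real part of the geometric series in
  \<open>z = r * cis (2 * pi * t)\<close>, started at exponent 1.\<close>

lemma poisson_kernel_sums:
  assumes r: "0 \<le> r" "r < 1"
  shows "(\<lambda>k. r ^ Suc k * cos (2 * pi * real (Suc k) * t)) sums ((poisson_kernel r t - 1) / 2)"
proof -
  define z where "z = of_real r * cis (2 * pi * t)"
  have nz: "norm z < 1" using r by (simp add: z_def norm_mult)
  let ?d = "1 - 2 * r * cos (2 * pi * t) + r\<^sup>2"
  have d: "?d \<noteq> 0" using poisson_kernel_denominator_pos[OF r, of "2 * pi * t"] by simp
  have "(\<lambda>k. Re (z ^ k * z)) sums Re (1 / (1 - z) * z)"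
    by (intro sums_Re sums_mult2 geometric_sums nz)
  moreover have "Re (z ^ k * z) = r ^ Suc k * cos (2 * pi * real (Suc k) * t)" for k
  proof -
    have "z ^ k * z = z ^ Suc k" by (rule power_Suc2[symmetric])
    also have "\<dots> = of_real (r ^ Suc k) * cis (real (Suc k) * (2 * pi * t))"
      by (simp only: z_def power_mult_distrib Complex.DeMoivre of_real_power)
    also have "Re \<dots> = r ^ Suc k * cos (2 * pi * real (Suc k) * t)"
      by (simp add: mult_ac)
    finally show ?thesis .
  qed
  moreover have "Re (1 / (1 - z) * z) = (poisson_kernel r t - 1) / 2"
  proof -
    have sq: "(r * sin (2 * pi * t))\<^sup>2 = r\<^sup>2 - (r * cos (2 * pi * t))\<^sup>2"
      by (simp add: power_mult_distrib sin_squared_eq algebra_simps)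
    have den: "(1 - r * cos (2 * pi * t))\<^sup>2 + (r * sin (2 * pi * t))\<^sup>2 = ?d"
      unfolding sq by (simp add: power2_eq_square algebra_simps)
    have "1 / (1 - z) * z = 1 / (1 - z) - 1"
      using nz by (cases "z = 1") (auto simp: field_simps)
    then have "Re (1 / (1 - z) * z) = (1 - r * cos (2 * pi * t)) / ?d - 1"
      using den by (simp add: Re_divide z_def power2_eq_square)
    also have "\<dots> = (poisson_kernel r t - 1) / 2"
      using d by (simp add: poisson_kernel_def field_simps)
    finally show ?thesis .
  qed
  ultimately show ?thesis by (simp only:)
qed

lemma continuous_on_poisson_kernel:
  "0 \<le> r \<Longrightarrow> r < 1 \<Longrightarrow> continuous_on A (poisson_kernel r)"
  unfolding poisson_kernel_def
  by (intro continuous_intros) (use poisson_kernel_denominator_pos in \<open>auto simp: less_le\<close>)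

lemma borel_measurable_poisson_kernel [measurable]: "poisson_kernel r \<in> borel_measurable borel"
  unfolding poisson_kernel_def by measurable

text \<open>The extreme case is \<open>cos = 1\<close>. The bound blows up as \<open>r\<close> tends
  to 1 and serves only for integrability at a fixed \<open>r\<close>.\<close>

lemma poisson_kernel_le:
  assumes r: "0 \<le> r" "r < 1"
  shows "poisson_kernel r t \<le> (1 + r) / (1 - r)"
proof -
  have "(1 - r)\<^sup>2 + 2 * r * (1 - cos (2 * pi * t)) = 1 - 2 * r * cos (2 * pi * t) + r\<^sup>2"
    by (simp add: power2_eq_square algebra_simps)
  moreover have "2 * r * (1 - cos (2 * pi * t)) \<ge> 0" using r by simp
  ultimately have "(1 - r)\<^sup>2 \<le> 1 - 2 * r * cos (2 * pi * t) + r\<^sup>2" by linarith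
  then have "poisson_kernel r t \<le> (1 - r\<^sup>2) / (1 - r)\<^sup>2"
    unfolding poisson_kernel_def using r by (intro divide_left_mono) (auto simp: power_le_one
      intro!: mult_pos_pos poisson_kernel_denominator_pos)
  also have "\<dots> = (1 + r) / (1 - r)"
    using r by (simp add: power2_eq_square divide_simps) (simp add: algebra_simps)
  finally show ?thesis .
qed

lemma poisson_kernel_integrable:
  fixes h :: "real \<Rightarrow> 'a :: {banach, second_countable_topology}"
  assumes r: "0 \<le> r" "r < 1" and h: "integrable lborel h"
  shows "integrable lborel (\<lambda>t. poisson_kernel r t *\<^sub>R h t)"
proof (rule Bochner_Integration.integrable_bound)
  show "integrable lborel (\<lambda>t. ((1 + r) / (1 - r)) *\<^sub>R h t)" using h by simp
  show "AE t in lborel. norm (poisson_kernel r t *\<^sub>R h t) \<le> norm (((1 + r) / (1 - r)) *\<^sub>R h t)"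
  proof (rule always_eventually, rule allI)
    fix t
    show "norm (poisson_kernel r t *\<^sub>R h t) \<le> norm (((1 + r) / (1 - r)) *\<^sub>R h t)"
      unfolding norm_scaleR using poisson_kernel_le[OF r, of t] poisson_kernel_nonneg[OF r, of t] r
      by (intro mult_right_mono) auto
  qed
  show "(\<lambda>t. poisson_kernel r t *\<^sub>R h t) \<in> borel_measurable lborel"
    using borel_measurable_integrable[OF h] by measurable
qed

text \<open>The factors \<open>r ^ Suc k\<close> justify termwise integration; the result is an Abel
  mean of the cosine coefficients of \<open>h\<close>. The value type stays open because real test
  functions as well as complex functions are inserted for \<open>h\<close>.\<close>

lemma integral_poisson_kernel:
  fixes h :: "real \<Rightarrow> 'a :: {banach, second_countable_topology}"
  assumes r: "0 \<le> r" "r < 1" and h: "integrable lborel h"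
  shows "(LINT t|lborel. poisson_kernel r t *\<^sub>R h t) = (LINT t|lborel. h t) +
           2 *\<^sub>R (\<Sum>k. r ^ Suc k *\<^sub>R (LINT t|lborel. cos (2 * pi * real (Suc k) * t) *\<^sub>R h t))"
proof -
  define T where "T = (\<lambda>k t. (r ^ Suc k * cos (2 * pi * real (Suc k) * t)) *\<^sub>R h t)"
  have [measurable]: "h \<in> borel_measurable lborel" by (rule borel_measurable_integrable[OF h])
  have T_le: "norm (T k t) \<le> r ^ Suc k * norm (h t)" for k t
    using r by (auto simp: T_def abs_mult simp del: power_Suc intro!: mult_right_mono mult_left_le)
  have T_int: "integrable lborel (T k)" for k
    by (rule Bochner_Integration.integrable_bound[of _ "\<lambda>t. r ^ Suc k *\<^sub>R h t"])
       (use h T_le[of k] r in \<open>auto simp del: power_Suc simp: T_def\<close>)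
  have sum_r: "summable (\<lambda>k. r ^ Suc k * c)" for c
    by (intro summable_mult2) (use r in \<open>simp add: summable_geometric del: power_Suc add: summable_Suc_iff\<close>)
  have T_summable: "summable (\<lambda>k. norm (T k t))" for t
    by (rule summable_comparison_test'[OF sum_r[of "norm (h t)"]]) (use T_le in auto)
  have T_summable': "summable (\<lambda>k. LINT t|lborel. norm (T k t))"
  proof (rule summable_comparison_test'[OF sum_r[of "LINT t|lborel. norm (h t)"]])
    fix k
    have "(LINT t|lborel. norm (T k t)) \<le> (LINT t|lborel. r ^ Suc k * norm (h t))"
      by (intro integral_mono) (use T_int h T_le in auto)
    then show "norm (LINT t|lborel. norm (T k t)) \<le> r ^ Suc k * (LINT t|lborel. norm (h t))"
      by simp
  qed
  have T_sums: "(\<lambda>k. T k t) sums (((poisson_kernel r t - 1) / 2) *\<^sub>R h t)" for t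
    unfolding T_def by (intro sums_scaleR_left poisson_kernel_sums r)
  have "poisson_kernel r t *\<^sub>R h t = h t + 2 *\<^sub>R (\<Sum>k. T k t)" for t
    unfolding sums_unique[OF T_sums, symmetric] by (simp add: algebra_simps diff_divide_distrib)
  then have "(LINT t|lborel. poisson_kernel r t *\<^sub>R h t) = (LINT t|lborel. h t + 2 *\<^sub>R (\<Sum>k. T k t))"
    by simp
  also have "\<dots> = (LINT t|lborel. h t) + 2 *\<^sub>R (LINT t|lborel. (\<Sum>k. T k t))"
    using h integrable_suminf[OF T_int _ T_summable'] T_summable by simp
  also have "(LINT t|lborel. (\<Sum>k. T k t)) = (\<Sum>k. LINT t|lborel. T k t)"
    by (rule integral_suminf[OF T_int _ T_summable']) (use T_summable in auto)
  also have "(\<lambda>k. LINT t|lborel. T k t) =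
      (\<lambda>k. r ^ Suc k *\<^sub>R (LINT t|lborel. cos (2 * pi * real (Suc k) * t) *\<^sub>R h t))"
    unfolding T_def scaleR_scaleR[symmetric] integral_scaleR_right by (rule refl)
  finally show ?thesis .
qed

section \<open>Moments of the Poisson kernel over one period and its limit\<close>

lemma integral_cos_period:
  assumes "k \<noteq> 0"
  shows "(LINT t:{0..1}|lborel. cos (2 * pi * of_int k * t)) = 0"
proof -
  have "(LBINT t=0..1. cos (2 * pi * of_int k * t)) =
     sin (2 * pi * of_int k * 1) / (2 * pi * of_int k) - sin (2 * pi * of_int k * 0) / (2 * pi * of_int k)"
    using assms
    by (intro interval_integral_FTC_finite[of 0 1, unfolded zero_ereal_def[symmetric] one_ereal_def[symmetric]])
       (auto intro!: continuous_intros derivative_eq_intros simp: has_real_derivative_iff_has_vector_derivative[symmetric])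
  also have "\<dots> = 0" using sin_integer_2pi[of "of_int k"] by (simp add: mult_ac)
  finally show ?thesis
    by (simp add: interval_integral_Icc[of 0 1, unfolded zero_ereal_def[symmetric] one_ereal_def[symmetric]])
qed

lemma
  assumes r: "0 \<le> r" "r < 1"
  shows integral_poisson_kernel_period: "(LINT t:{0..1}|lborel. poisson_kernel r t) = 1"
    and integral_poisson_kernel_cos:
      "(LINT t:{0..1}|lborel. poisson_kernel r t * cos (2 * pi * t)) = r"
proof -
  have "(LINT t:{0..1}|lborel. poisson_kernel r t) =
        (LINT t|lborel. poisson_kernel r t *\<^sub>R indicator {0..1::real} t)"
    by (simp add: set_lebesgue_integral_def mult.commute)
  also have "\<dots> = (LINT t|lborel. indicator {0..1::real} t) + 2 *\<^sub>R (\<Sum>k. r ^ Suc k *\<^sub>R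
      (LINT t|lborel. cos (2 * pi * real (Suc k) * t) *\<^sub>R indicator {0..1::real} t))"
    by (rule integral_poisson_kernel[OF r, of "indicator {0..1}"]) simp
  also have "(\<lambda>k. LINT t|lborel. cos (2 * pi * real (Suc k) * t) *\<^sub>R indicator {0..1::real} t) = (\<lambda>k. 0::real)"
  proof
    fix k
    show "(LINT t|lborel. cos (2 * pi * real (Suc k) * t) *\<^sub>R indicator {0..1::real} t) = (0::real)"
      using integral_cos_period[of "int (Suc k)"] by (simp add: set_lebesgue_integral_def mult.commute)
  qed
  finally show "(LINT t:{0..1}|lborel. poisson_kernel r t) = 1" by simp
  \<comment> \<open>The product formula produces the frequencies \<open>k\<close> and
    \<open>k + 2\<close>. Index \<open>k\<close> stands for frequency \<open>Suc k\<close>, so only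
    \<open>k = 0\<close> leaves a constant term, with mean 1/2.\<close>
  have cc: "(LINT t|lborel. cos (2 * pi * real (Suc k) * t) *\<^sub>R (cos (2 * pi * t) * indicator {0..1::real} t))
     = (if k = 0 then 1 / 2 else 0 :: real)" for k
  proof -
    have "(LINT t|lborel. cos (2 * pi * real (Suc k) * t) *\<^sub>R (cos (2 * pi * t) * indicator {0..1::real} t)) =
      (LINT t:{0..1}|lborel. (cos (2 * pi * of_int (int k) * t) + cos (2 * pi * of_int (int k + 2) * t)) / 2)"
      unfolding set_lebesgue_integral_def
      by (rule Bochner_Integration.integral_cong)
         (auto simp: cos_times_cos algebra_simps split: split_indicator)
    also have "\<dots> = ((LINT t:{0..1}|lborel. cos (2 * pi * of_int (int k) * t)) +
        (LINT t:{0..1}|lborel. cos (2 * pi * of_int (int k + 2) * t))) / 2"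
      by (subst set_integral_add(2)[symmetric])
         (auto intro!: borel_integrable_atLeastAtMost' continuous_intros)
    also have "(LINT t:{0..1}|lborel. cos (2 * pi * of_int (int k + 2) * t)) = 0"
      by (rule integral_cos_period) simp
    also have "(LINT t:{0..1}|lborel. cos (2 * pi * of_int (int k) * t)) = (if k = 0 then 1 else 0)"
      using integral_cos_period[of "int k"] by (auto simp: set_lebesgue_integral_def)
    finally show ?thesis by auto
  qed
  have "(LINT t:{0..1}|lborel. poisson_kernel r t * cos (2 * pi * t)) =
        (LINT t|lborel. poisson_kernel r t *\<^sub>R (cos (2 * pi * t) * indicator {0..1::real} t))"
    by (simp add: set_lebesgue_integral_def mult_ac)
  also have "\<dots> = (LINT t|lborel. cos (2 * pi * t) * indicator {0..1::real} t) + 2 *\<^sub>R (\<Sum>k. r ^ Suc k *\<^sub>R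
      (LINT t|lborel. cos (2 * pi * real (Suc k) * t) *\<^sub>R (cos (2 * pi * t) * indicator {0..1::real} t)))"
  proof (rule integral_poisson_kernel[OF r, of "\<lambda>t. cos (2 * pi * t) * indicator {0..1::real} t"])
    have "set_integrable lborel {0..1} (\<lambda>t. cos (2 * pi * t))"
      by (intro borel_integrable_atLeastAtMost' continuous_intros)
    then show "integrable lborel (\<lambda>t. cos (2 * pi * t) * indicator {0..1::real} t)"
      by (simp add: set_integrable_def mult.commute)
  qed
  also have "(LINT t|lborel. cos (2 * pi * t) * indicator {0..1::real} t) = 0"
    using integral_cos_period[of 1] by (simp add: set_lebesgue_integral_def mult.commute)
  also have "(\<Sum>k. r ^ Suc k *\<^sub>R
      (LINT t|lborel. cos (2 * pi * real (Suc k) * t) *\<^sub>R (cos (2 * pi * t) * indicator {0..1::real} t)))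
      = (\<Sum>k. if k = 0 then r / 2 else 0)"
    unfolding cc by (intro suminf_cong) simp
  also have "\<dots> = r / 2"
    using sums_If_finite_set[of "{0::nat}" "\<lambda>_. r / 2"] by (simp add: sums_iff)
  finally show "(LINT t:{0..1}|lborel. poisson_kernel r t * cos (2 * pi * t)) = r" by simp
qed

text \<open>Korovkin's argument: the kernel is positive, so its limit is determined by its action
  on \<open>1\<close> and on \<open>1 - cos (2 * pi * t)\<close>.\<close>
lemma poisson_kernel_limit:
  fixes G :: "real \<Rightarrow> complex" and r :: "nat \<Rightarrow> real"
  assumes G: "continuous_on {0..1} G"
    and r: "\<And>j. 0 \<le> r j" "\<And>j. r j < 1" "r \<longlonglongrightarrow> 1"
  shows "(\<lambda>j. LINT t:{0..1}|lborel. poisson_kernel (r j) t *\<^sub>R G t) \<longlonglongrightarrow> (G 0 + G 1) / 2"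
proof -
  \<comment> \<open>The kernel is invariant under \<open>t \<mapsto> 1 - t\<close>, so
    \<open>G\<close> may be replaced by its symmetric part \<open>S\<close>. Both end values of
    \<open>S\<close> equal \<open>A\<close>, hence its deviation from \<open>A\<close> can be
    controlled by \<open>1 - cos (2 * pi * t)\<close>, which vanishes at both ends.\<close>
  define S where "S = (\<lambda>t. (G t + G (1 - t)) / 2)"
  define A where "A = (G 0 + G 1) / 2"
  have contG': "continuous_on {0..1} (\<lambda>t. G (1 - t))"
    by (rule continuous_on_compose2[OF G]) (auto intro!: continuous_intros)
  have contS: "continuous_on {0..1} S"
    unfolding S_def by (intro continuous_intros G contG') auto
  have S_sym: "S (1 - t) = S t" for t by (simp add: S_def add.commute)
  have int: "set_integrable lborel {0..1} (\<lambda>t. poisson_kernel (r j) t *\<^sub>R H t)"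
    if "continuous_on {0..1} H" for j and H :: "real \<Rightarrow> complex"
    by (intro borel_integrable_atLeastAtMost' continuous_intros that continuous_on_poisson_kernel r)
  have refl: "(LINT t:{0..1}|lborel. poisson_kernel (r j) t *\<^sub>R G (1 - t)) =
        (LINT t:{0..1}|lborel. poisson_kernel (r j) t *\<^sub>R G t)" for j
  proof -
    have per: "poisson_kernel (r j) (1 - t) = poisson_kernel (r j) t" for t
    proof -
      have "cos (2 * pi * (1 - t)) = cos (2 * pi * t)"
        using cos_diff[of "2 * pi" "2 * pi * t"] by (simp add: right_diff_distrib)
      then show ?thesis by (simp add: poisson_kernel_def)
    qed
    show ?thesis
      unfolding set_lebesgue_integral_def
      by (subst lborel_integral_real_affine[where c = "-1" and t = 1])
         (auto simp: per intro!: Bochner_Integration.integral_cong split: split_indicator)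
  qed
  have GS: "(LINT t:{0..1}|lborel. poisson_kernel (r j) t *\<^sub>R G t) =
      (LINT t:{0..1}|lborel. poisson_kernel (r j) t *\<^sub>R S t)" for j
  proof -
    have "(LINT t:{0..1}|lborel. poisson_kernel (r j) t *\<^sub>R S t) =
        (LINT t:{0..1}|lborel. (poisson_kernel (r j) t *\<^sub>R G t + poisson_kernel (r j) t *\<^sub>R G (1 - t)) / 2)"
      by (simp add: S_def scaleR_add_right scaleR_conv_of_real ring_distribs)
    also have "\<dots> = (LINT t:{0..1}|lborel. poisson_kernel (r j) t *\<^sub>R G t)"
      using int[OF G, of j] int[OF contG', of j] by (simp add: refl)
    finally show ?thesis ..
  qed
  have SA: "\<exists>K\<ge>0. \<forall>t\<in>{0..1}. norm (S t - A) \<le> e + K * (1 - cos (2 * pi * t))" if e: "e > 0" for e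
  proof -
    obtain d where d: "d > 0" "\<And>t. t \<in> {0..1} \<Longrightarrow> dist t 0 < d \<Longrightarrow> dist (S t) (S 0) < e"
      using contS e unfolding continuous_on_iff by (metis atLeastAtMost_iff order_refl zero_le_one)
    \<comment> \<open>The cap 1/2 keeps \<open>2 * pi * d'\<close> in the range where the cosine
      decreases.\<close>
    define d' where "d' = min d (1/2)"
    have d': "0 < d'" "d' \<le> 1/2" "d' \<le> d" using d by (auto simp: d'_def)
    have "bounded ((\<lambda>t. S t - A) ` {0..1})"
      by (intro compact_imp_bounded compact_continuous_image continuous_intros contS) auto
    then obtain B where B: "\<And>t. t \<in> {0..1} \<Longrightarrow> norm (S t - A) \<le> B"
      by (auto simp: bounded_iff simp del: atLeastAtMost_iff)
    have B0: "B \<ge> 0" using B[of 0] norm_ge_zero[of "S 0 - A"] by (meson atLeastAtMost_iff order_refl order_trans zero_le_one)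
    have "cos (2 * pi * d') < cos 0"
      using d' by (intro cos_monotone_0_pi) auto
    then have c: "cos (2 * pi * d') < 1" by simp
    \<comment> \<open>\<open>K\<close> raises the value of \<open>1 - cos (2 * pi * t)\<close> at
      \<open>t = d'\<close> to the uniform bound \<open>B\<close>; between \<open>d'\<close> and 1/2
      the second summand alone then suffices, and symmetry covers the other half.\<close>
    define K where "K = B / (1 - cos (2 * pi * d'))"
    have K: "K \<ge> 0" using B0 c by (simp add: K_def)
    have *: "norm (S t - A) \<le> e + K * (1 - cos (2 * pi * t))" if t: "0 \<le> t" "t \<le> 1/2" for t
    proof (cases "t < d'")
      case True
      then have "norm (S t - A) < e"
        using d(2)[of t] t d' by (auto simp: dist_norm S_def A_def)
      moreover have "K * (1 - cos (2 * pi * t)) \<ge> 0" using K by simp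
      ultimately show ?thesis by linarith
    next
      case False
      then have "cos (2 * pi * t) \<le> cos (2 * pi * d')"
        using t d' by (intro cos_monotone_0_pi_le) auto
      then have "K * (1 - cos (2 * pi * d')) \<le> K * (1 - cos (2 * pi * t))"
        using K by (intro mult_left_mono) auto
      moreover have "K * (1 - cos (2 * pi * d')) = B" using c by (simp add: K_def)
      ultimately show ?thesis using B[of t] t e by simp
    qed
    have "norm (S t - A) \<le> e + K * (1 - cos (2 * pi * t))" if t: "t \<in> {0..1}" for t
    proof (cases "t \<le> 1/2")
      case False
      have "cos (2 * pi * (1 - t)) = cos (2 * pi * t)"
        using cos_diff[of "2 * pi" "2 * pi * t"] by (simp add: right_diff_distrib)
      then show ?thesis using *[of "1 - t"] t False S_sym[of t] by simp
    qed (use * t in auto)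
    then show ?thesis using K by blast
  qed
  have "(\<lambda>j. LINT t:{0..1}|lborel. poisson_kernel (r j) t *\<^sub>R S t) \<longlonglongrightarrow> A"
  proof (rule LIMSEQ_I)
    fix e :: real assume e: "e > 0"
    then obtain K where K: "K \<ge> 0"
        "\<And>t. t \<in> {0..1} \<Longrightarrow> norm (S t - A) \<le> e / 2 + K * (1 - cos (2 * pi * t))"
      using SA[of "e / 2"] by auto
    have "(\<lambda>j. e / 2 + K * (1 - r j)) \<longlonglongrightarrow> e / 2 + K * (1 - 1)"
      by (intro tendsto_intros r)
    then have "\<forall>\<^sub>F j in sequentially. e / 2 + K * (1 - r j) < e"
      using e by (intro order_tendstoD(2)[where y = "e / 2 + K * (1 - 1)"]) auto
    then obtain N where N: "\<And>j. j \<ge> N \<Longrightarrow> e / 2 + K * (1 - r j) < e"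
      by (auto simp: eventually_sequentially)
    have "norm ((LINT t:{0..1}|lborel. poisson_kernel (r j) t *\<^sub>R S t) - A) < e" if "j \<ge> N" for j
    proof -
      let ?P = "poisson_kernel (r j)"
      have iP: "set_integrable lborel {0..1} (\<lambda>t. ?P t * q t)" if "continuous_on {0..1} q" for q
        by (intro borel_integrable_atLeastAtMost' continuous_intros that continuous_on_poisson_kernel r)
      have iP1: "set_integrable lborel {0..1} ?P"
        by (intro borel_integrable_atLeastAtMost' continuous_on_poisson_kernel r)
      have iPc: "set_integrable lborel {0..1} (\<lambda>t. ?P t * cos (2 * pi * t))"
        by (intro iP continuous_intros)
      have contSA: "continuous_on {0..1} (\<lambda>t. S t - A)" by (intro continuous_intros contS)
      have "(LINT t:{0..1}|lborel. ?P t *\<^sub>R A) = A"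
        using integral_poisson_kernel_period[OF r(1,2), of j] iP1
        by (simp add: set_lebesgue_integral_def set_integrable_def scaleR_scaleR)
      then have "(LINT t:{0..1}|lborel. ?P t *\<^sub>R S t) - A =
         (LINT t:{0..1}|lborel. ?P t *\<^sub>R S t) - (LINT t:{0..1}|lborel. ?P t *\<^sub>R A)" by simp
      also have "\<dots> = (LINT t:{0..1}|lborel. ?P t *\<^sub>R (S t - A))"
        unfolding scaleR_diff_right using int[OF contS, of j] int[of "\<lambda>_. A" j]
        by (subst set_integral_diff) auto
      also have "norm \<dots> \<le> (LINT t:{0..1}|lborel. norm (?P t *\<^sub>R (S t - A)))"
        by (rule set_integral_norm_bound[OF int[OF contSA]])
      also have "\<dots> \<le> (LINT t:{0..1}|lborel. (e / 2 + K) * ?P t - K * (?P t * cos (2 * pi * t)))"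
      proof (rule set_integral_mono)
        show "set_integrable lborel {0..1} (\<lambda>t. norm (?P t *\<^sub>R (S t - A)))"
          by (rule set_integrable_norm[OF int[OF contSA]])
        show "set_integrable lborel {0..1} (\<lambda>t. (e / 2 + K) * ?P t - K * (?P t * cos (2 * pi * t)))"
          by (intro set_integral_diff(1) set_integrable_mult_right iP1 iP continuous_intros)
        show "norm (?P t *\<^sub>R (S t - A)) \<le> (e / 2 + K) * ?P t - K * (?P t * cos (2 * pi * t))"
          if "t \<in> {0..1}" for t
        proof -
          have "norm (?P t *\<^sub>R (S t - A)) \<le> ?P t * (e / 2 + K * (1 - cos (2 * pi * t)))"
            using K(2)[OF that] poisson_kernel_nonneg[OF r(1,2), of j t]
            by (auto intro!: mult_left_mono)
          then show ?thesis by (simp add: algebra_simps)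
        qed
      qed
      \<comment> \<open>The two moments of the kernel turn the pointwise majorant into
        \<open>e / 2 + K * (1 - r j)\<close>.\<close>
      also have "\<dots> = (e / 2 + K) * 1 - K * r j"
        using integral_poisson_kernel_period[OF r(1,2), of j] integral_poisson_kernel_cos[OF r(1,2), of j]
          iP1 iPc by (subst set_integral_diff(2)) (auto intro!: set_integrable_mult_right)
      also have "\<dots> < e" using N[OF that] by (simp add: algebra_simps)
      finally show ?thesis .
    qed
    then show "\<exists>N. \<forall>j\<ge>N. norm ((LINT t:{0..1}|lborel. poisson_kernel (r j) t *\<^sub>R S t) - A) < e"
      by blast
  qed
  then show ?thesis unfolding GS A_def .
qed

text \<open>The integral of \<open>g\<close> over the half-line against the Poisson kernel is
  evaluated twice in the limit of parameter 1. Expanding the kernel into cosines gives Abel means of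
  the cosine series; cutting the half-line into unit intervals gives means of end values of
  \<open>g\<close>.\<close>

lemma poisson_summation_half_line:
  fixes g :: "real \<Rightarrow> complex"
  assumes cont: "continuous_on {0..} g" and int: "set_integrable lborel {0..} g"
    and bound: "\<And>x. x \<ge> 0 \<Longrightarrow> norm (g x) \<le> C * (1 + x) powr (- \<alpha>)" and \<alpha>: "\<alpha> > 1"
    and sm: "summable (\<lambda>k. norm (fourier_cos g (real (Suc k))))"
  shows "fourier_cos g 0 + 2 * (\<Sum>k. fourier_cos g (real (Suc k))) = g 0 / 2 + (\<Sum>k. g (real (Suc k)))"
proof -
  define r where "r = (\<lambda>j. real j / real (Suc j))"
  have r: "0 \<le> r j" "r j < 1" for j by (auto simp: r_def)
  have r_lim: "r \<longlonglongrightarrow> 1" unfolding r_def by (rule LIMSEQ_n_over_Suc_n)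
  define h where "h = (\<lambda>t. indicator {0..} t *\<^sub>R g t)"
  have h: "integrable lborel h" using int by (simp add: h_def set_integrable_def)
  have F: "(LINT t|lborel. cos (2 * pi * w * t) *\<^sub>R h t) = fourier_cos g w" for w
    unfolding fourier_cos_def set_lebesgue_integral_def h_def
    by (intro Bochner_Integration.integral_cong) (auto simp: scaleR_conv_of_real split: split_indicator)
  have "(LINT t|lborel. poisson_kernel (r j) t *\<^sub>R h t) =
      fourier_cos g 0 + 2 * (\<Sum>k. of_real (r j ^ Suc k) * fourier_cos g (real (Suc k)))" for j
    using integral_poisson_kernel[OF r h, of j] F[of 0]
    by (simp add: F[unfolded scaleR_conv_of_real] scaleR_conv_of_real del: of_nat_Suc power_Suc)
  \<comment> \<open>This is Abel's limit theorem in the absolutely convergent case: the series in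
    \<open>sm\<close> dominates uniformly in \<open>j\<close>.\<close>
  moreover have "(\<lambda>j. fourier_cos g 0 + 2 * (\<Sum>k. of_real (r j ^ Suc k) * fourier_cos g (real (Suc k))))
      \<longlonglongrightarrow> fourier_cos g 0 + 2 * (\<Sum>k. of_real (1 ^ Suc k) * fourier_cos g (real (Suc k)))"
  proof (intro tendsto_intros)
    have "\<forall>\<^sub>F (k, j) in at_top \<times>\<^sub>F sequentially.
        norm (of_real (r j ^ Suc k) * fourier_cos g (real (Suc k))) \<le> norm (fourier_cos g (real (Suc k)))"
    proof (rule always_eventually, clarify)
      fix k j :: nat
      have "\<bar>r j ^ Suc k\<bar> \<le> 1" using r[of j] by (simp add: power_le_one del: power_Suc)
      then show "norm (of_real (r j ^ Suc k) * fourier_cos g (real (Suc k))) \<le> norm (fourier_cos g (real (Suc k)))"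
        by (simp add: norm_mult mult_left_le_one_le del: power_Suc of_nat_Suc of_real_power)
    qed
    then show "(\<lambda>j. \<Sum>k. of_real (r j ^ Suc k) * fourier_cos g (real (Suc k))) \<longlonglongrightarrow>
       (\<Sum>k. of_real (1 ^ Suc k) * fourier_cos g (real (Suc k)))"
      by (intro tannerys_theorem[THEN conjunct2, THEN conjunct2, OF _ _ sm] tendsto_intros r_lim) auto
  qed
  ultimately have lim1: "(\<lambda>j. LINT t|lborel. poisson_kernel (r j) t *\<^sub>R h t) \<longlonglongrightarrow>
      fourier_cos g 0 + 2 * (\<Sum>k. fourier_cos g (real (Suc k)))"
    by simp

  \<comment> \<open>Periodicity of the kernel moves every unit interval to \<open>{0..1}\<close>,
    where \<open>poisson_kernel_limit\<close> yields the mean of the two end values.\<close>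
  define I where "I = (\<lambda>n j. LINT t:{0..1}|lborel. poisson_kernel (r j) t *\<^sub>R g (real n + t))"
  have contg: "continuous_on {0..1} (\<lambda>t. g (real n + t))" for n
    by (rule continuous_on_compose2[OF cont]) (auto intro!: continuous_intros)
  have split: "(LINT t|lborel. poisson_kernel (r j) t *\<^sub>R h t) = (\<Sum>n. I n j)" for j
  proof -
    let ?q = "\<lambda>t. poisson_kernel (r j) t *\<^sub>R g t"
    have U: "(\<Union>n. {real n..<real n + 1}) = {0..}"
    proof (intro equalityI subsetI)
      fix x :: real assume "x \<in> {0..}"
      then have "x \<in> {real (nat \<lfloor>x\<rfloor>)..<real (nat \<lfloor>x\<rfloor>) + 1}" by auto
      then show "x \<in> (\<Union>n. {real n..<real n + 1})" by blast
    qed auto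
    have "(LINT t|lborel. poisson_kernel (r j) t *\<^sub>R h t) = (LINT t:(\<Union>n. {real n..<real n + 1})|lborel. ?q t)"
      unfolding U by (simp add: h_def set_lebesgue_integral_def mult_ac)
    also have "\<dots> = (\<Sum>n. LINT t:{real n..<real n + 1}|lborel. ?q t)"
    proof (rule lebesgue_integral_countable_add)
      show "{real n..<real n + 1} \<inter> {real m..<real m + 1} = {}" if "n \<noteq> m" for n m using that by auto
      show "set_integrable lborel (\<Union>n. {real n..<real n + 1}) ?q"
        unfolding U using poisson_kernel_integrable[OF r h, of j]
        by (simp add: h_def set_integrable_def mult_ac)
    qed auto
    also have "(\<lambda>n. LINT t:{real n..<real n + 1}|lborel. ?q t) = (\<lambda>n. I n j)"
    proof
      fix n
      have per: "poisson_kernel (r j) (real n + t) = poisson_kernel (r j) t" for t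
      proof -
        have "cos (2 * pi * (real n + t)) = cos (2 * pi * t)"
          using cos.plus_of_nat[of "2 * pi * t" n] by (simp add: algebra_simps)
        then show ?thesis by (simp add: poisson_kernel_def)
      qed
      have "(LINT t:{real n..<real n + 1}|lborel. ?q t) = (LINT t:{0..<1}|lborel. ?q (real n + t))"
        unfolding set_lebesgue_integral_def
        by (subst lborel_integral_real_affine[where c = 1 and t = "real n"])
           (auto intro!: Bochner_Integration.integral_cong split: split_indicator)
      \<comment> \<open>Half-open intervals partition the half-line, while the kernel limit is
        stated on the closed interval; the two differ by a null set.\<close>
      also have "\<dots> = I n j"
        unfolding I_def per
      proof (rule set_integral_cong_set)
        have "continuous_on {0..1} (\<lambda>t. poisson_kernel (r j) t *\<^sub>R g (real n + t))"
          by (intro continuous_intros continuous_on_poisson_kernel r contg)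
        then have *: "set_borel_measurable lborel A (\<lambda>t. poisson_kernel (r j) t *\<^sub>R g (real n + t))"
          if "A \<subseteq> {0..1}" "A \<in> sets borel" for A
          unfolding set_borel_measurable_def measurable_lborel2
          using that by (intro borel_measurable_continuous_on_indicator) (auto intro: continuous_on_subset)
        show "set_borel_measurable lborel {0..<1} (\<lambda>t. poisson_kernel (r j) t *\<^sub>R g (real n + t))"
          "set_borel_measurable lborel {0..1} (\<lambda>t. poisson_kernel (r j) t *\<^sub>R g (real n + t))"
          by (rule *; auto)+
        show "AE t in lborel. (t \<in> {0..1::real}) = (t \<in> {0..<1})"
          using AE_lborel_singleton[of "1::real"] by (auto elim!: eventually_mono)
      qed
      finally show "(LINT t:{real n..<real n + 1}|lborel. ?q t) = I n j" .
    qed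
    finally show ?thesis .
  qed
  \<comment> \<open>The kernel has mass one on each period, so the bound does not depend on
    \<open>j\<close>; as \<alpha> exceeds 1 it is summable in \<open>n\<close> and Tannery's theorem
    applies.\<close>
  have I_bound: "norm (I n j) \<le> C * real (Suc n) powr (- \<alpha>)" for n j
  proof -
    let ?B = "C * real (Suc n) powr (- \<alpha>)"
    have C: "C \<ge> 0" using bound[of 0] norm_ge_zero[of "g 0"] by (simp del: norm_ge_zero)
    have iP1: "set_integrable lborel {0..1} (poisson_kernel (r j))"
      by (intro borel_integrable_atLeastAtMost' continuous_on_poisson_kernel r)
    have i1: "set_integrable lborel {0..1} (\<lambda>t. poisson_kernel (r j) t *\<^sub>R g (real n + t))"
      by (intro borel_integrable_atLeastAtMost' continuous_intros continuous_on_poisson_kernel r contg)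
    have "norm (I n j) \<le> (LINT t:{0..1}|lborel. norm (poisson_kernel (r j) t *\<^sub>R g (real n + t)))"
      unfolding I_def by (rule set_integral_norm_bound[OF i1])
    also have "\<dots> \<le> (LINT t:{0..1}|lborel. poisson_kernel (r j) t * ?B)"
    proof (rule set_integral_mono[OF set_integrable_norm[OF i1]])
      show "set_integrable lborel {0..1} (\<lambda>t. poisson_kernel (r j) t * ?B)"
        using iP1 by simp
      fix t :: real assume t: "t \<in> {0..1}"
      have "norm (g (real n + t)) \<le> C * (1 + (real n + t)) powr (- \<alpha>)" by (rule bound) (use t in auto)
      also have "\<dots> \<le> ?B" using t \<alpha> C by (intro mult_left_mono powr_mono2') auto
      finally show "norm (poisson_kernel (r j) t *\<^sub>R g (real n + t)) \<le> poisson_kernel (r j) t * ?B"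
        using poisson_kernel_nonneg[OF r, of j t] by (auto intro!: mult_left_mono)
    qed
    also have "\<dots> = ?B" using integral_poisson_kernel_period[OF r, of j] by simp
    finally show ?thesis .
  qed
  have sC: "summable (\<lambda>n. C * real (Suc n) powr (- \<alpha>))"
    by (intro summable_mult summable_Suc_powr \<alpha>)
  have "(\<lambda>j. \<Sum>n. I n j) \<longlonglongrightarrow> (\<Sum>n. (g (real n) + g (real n + 1)) / 2)"
  proof (rule tannerys_theorem[THEN conjunct2, THEN conjunct2, OF _ _ sC])
    show "(\<lambda>j. I n j) \<longlonglongrightarrow> (g (real n) + g (real n + 1)) / 2" for n
      using poisson_kernel_limit[OF contg r r_lim, of n] by (simp add: I_def)
    show "\<forall>\<^sub>F (n, j) in at_top \<times>\<^sub>F sequentially. norm (I n j) \<le> C * real (Suc n) powr (- \<alpha>)"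
      by (rule always_eventually) (use I_bound in auto)
  qed auto
  then have lim2: "(\<lambda>j. LINT t|lborel. poisson_kernel (r j) t *\<^sub>R h t) \<longlonglongrightarrow>
      (\<Sum>n. (g (real n) + g (real n + 1)) / 2)"
    unfolding split .
  have sg: "summable (\<lambda>n. g (real n))"
    by (rule summable_comparison_test'[OF sC, of 0]) (use bound[of "real _"] in simp)
  then have sg': "summable (\<lambda>n. g (real (Suc n)))" using summable_Suc_iff[of "\<lambda>n. g (real n)"] by simp
  \<comment> \<open>Every positive integer is an end of two unit intervals and 0 of only one, whence
    the term \<open>g 0 / 2\<close>.\<close>
  have "(\<Sum>n. (g (real n) + g (real n + 1)) / 2) = ((\<Sum>n. g (real n)) + (\<Sum>n. g (real (Suc n)))) / 2"
    using suminf_divide[OF summable_add[OF sg sg'], of 2] suminf_add[OF sg sg'] by (simp add: add.commute)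
  also have "(\<Sum>n. g (real n)) = g 0 + (\<Sum>n. g (real (Suc n)))"
    using suminf_split_head[OF sg] by simp
  also have "(\<dots> + (\<Sum>n. g (real (Suc n)))) / 2 = g 0 / 2 + (\<Sum>n. g (real (Suc n)))"
    by (simp add: field_simps)
  finally show ?thesis using LIMSEQ_unique[OF lim1 lim2] by simp
qed

section \<open>Gaussian summation of principal values\<close>

text \<open>Normalised to the value 1 at 0 instead of to integral 1: for growing \<open>R\<close> it
  is a smooth cut-off at height about \<open>R\<close>, tending pointwise to 1.\<close>

definition gauss_weight :: "real \<Rightarrow> real \<Rightarrow> real" where
  "gauss_weight R t = exp (- (t / R)\<^sup>2 / 2)"

lemma gauss_weight_pos: "gauss_weight R t > 0"
  by (simp add: gauss_weight_def)

lemma gauss_weight_minus: "gauss_weight R (- t) = gauss_weight R t"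
  by (simp add: gauss_weight_def)

lemma borel_measurable_gauss_weight [measurable]: "gauss_weight R \<in> borel_measurable borel"
  unfolding gauss_weight_def by measurable

lemma gauss_weight_conv_normal_density:
  assumes "R > 0"
  shows "gauss_weight R t = sqrt (2 * pi) * R * normal_density 0 R t"
  using assms by (simp add: gauss_weight_def normal_density_def real_sqrt_mult power_divide)

lemma integrable_gauss_weight_moment:
  assumes "R > 0"
  shows "integrable lborel (\<lambda>t. gauss_weight R t * \<bar>t\<bar> ^ k)"
proof -
  have "integrable lborel (\<lambda>t. sqrt (2 * pi) * R * (normal_density 0 R t * \<bar>t - 0\<bar> ^ k))"
    using integrable_normal_moment_abs[OF assms, of 0 k] by (rule integrable_mult_right)
  then show ?thesis
    by (simp add: gauss_weight_conv_normal_density[OF assms] mult.assoc)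
qed

lemma has_real_derivative_gauss_weight:
  "R > 0 \<Longrightarrow> (gauss_weight R has_real_derivative - (t / R\<^sup>2 * gauss_weight R t)) (at t)"
  unfolding gauss_weight_def
  by (auto intro!: derivative_eq_intros simp: field_simps power2_eq_square)

lemma gauss_weight_tendsto_0:
  assumes "R > 0"
  shows "(gauss_weight R \<longlongrightarrow> 0) at_top"
  using assms unfolding gauss_weight_def by real_asymp

text \<open>The function \<open>- gauss_weight 1\<close> is a primitive of the integrand. The value
  1 makes \<open>u * gauss_weight 1 u\<close> a probability density on \<open>u > 0\<close>.\<close>

lemma integral_gauss_weight_first_moment:
  "(LINT u:{0<..}|lborel. u * gauss_weight 1 u) = 1"
proof -
  have "(LBINT u=0..\<infinity>. u * gauss_weight 1 u) = 0 - (- 1)"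
  proof (rule interval_integral_FTC_integrable[where F = "\<lambda>u. - gauss_weight 1 u"])
    fix u :: real
    show "((\<lambda>u. - gauss_weight 1 u) has_vector_derivative u * gauss_weight 1 u) (at u)"
      using DERIV_minus[OF has_real_derivative_gauss_weight[of 1 u]]
      by (simp add: has_real_derivative_iff_has_vector_derivative)
    show "isCont (\<lambda>u. u * gauss_weight 1 u) u"
      unfolding gauss_weight_def by (intro continuous_intros) auto
  next
    have "integrable lborel (\<lambda>u. indicator {0<..} u *\<^sub>R (gauss_weight 1 u * \<bar>u\<bar> ^ 1))"
      by (intro integrable_mult_indicator integrable_gauss_weight_moment) auto
    then show "set_integrable lborel (einterval 0 \<infinity>) (\<lambda>u. u * gauss_weight 1 u)"
      unfolding set_integrable_def
      by (rule Bochner_Integration.integrable_cong[THEN iffD1, rotated -1])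
         (auto simp: einterval_def zero_ereal_def split: split_indicator)
    show "(((\<lambda>u. - gauss_weight 1 u) \<circ> real_of_ereal) \<longlongrightarrow> - 1) (at_right 0)"
      unfolding zero_ereal_def ereal_tendsto_simps gauss_weight_def by real_asymp
    show "(((\<lambda>u. - gauss_weight 1 u) \<circ> real_of_ereal) \<longlongrightarrow> 0) (at_left \<infinity>)"
      unfolding ereal_tendsto_simps using tendsto_minus[OF gauss_weight_tendsto_0[of 1]] by simp
  qed auto
  then show ?thesis by (simp add: interval_lebesgue_integral_0_infty)
qed

text \<open>Integration by parts rewrites the weighted integral as an average of the symmetric
  partial integrals against the probability density \<open>u * exp (- u\<^sup>2 / 2)\<close> on \<open>u > 0\<close>.\<close>
lemma gauss_weight_abelian:
  fixes \<phi> :: "real \<Rightarrow> complex"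
  assumes cont: "\<And>t. isCont \<phi> t"
    and lim: "((\<lambda>T. integral {-T..T} \<phi>) \<longlongrightarrow> L) at_top"
    and int: "\<And>R. R > 0 \<Longrightarrow> integrable lborel (\<lambda>t. gauss_weight R t *\<^sub>R \<phi> t)"
  shows "(\<lambda>j. LINT t|lborel. gauss_weight (real (Suc j)) t *\<^sub>R \<phi> t) \<longlonglongrightarrow> L"
proof -
  have [measurable]: "\<phi> \<in> borel_measurable borel"
    by (intro borel_measurable_continuous_onI continuous_at_imp_continuous_on ballI cont)
  obtain Q where Q: "\<And>t. (Q has_vector_derivative \<phi> t) (at t)"
    using einterval_antiderivative[of "-\<infinity>" \<infinity> \<phi>] cont by auto
  \<comment> \<open>For \<open>T \<ge> 0\<close> this is the integral of \<phi> over
    \<open>{-T..T}\<close>. It is bounded on the half-line, by convergence far out and by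
    compactness before that.\<close>
  define P where "P = (\<lambda>T. Q T - Q (- T))"
  have P': "(P has_vector_derivative \<phi> t + \<phi> (- t)) (at t)" for t
  proof -
    have "((Q \<circ> uminus) has_vector_derivative (- 1) *\<^sub>R \<phi> (- t)) (at t)"
      by (rule vector_diff_chain_at) (use Q in \<open>auto intro!: derivative_eq_intros\<close>)
    then have "((\<lambda>T. Q (- T)) has_vector_derivative - \<phi> (- t)) (at t)" by (simp add: o_def)
    from has_vector_derivative_diff[OF Q this] show ?thesis by (simp add: P_def)
  qed
  have contP: "isCont P t" for t
    by (rule has_vector_derivative_continuous[OF P'])
  have contP': "continuous_on A P" for A
    by (simp add: continuous_at_imp_continuous_on contP)
  then have [measurable]: "P \<in> borel_measurable borel" by (rule borel_measurable_continuous_onI)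
  have P0: "P 0 = 0" by (simp add: P_def)
  have "integral {-T..T} \<phi> = P T" if "T \<ge> 0" for T
    unfolding P_def using that
    by (intro integral_unique fundamental_theorem_of_calculus has_vector_derivative_at_within[OF Q]) auto
  then have limP: "(P \<longlongrightarrow> L) at_top"
    by (intro Lim_transform_eventually[OF lim] eventually_mono[OF eventually_ge_at_top[of 0]]) auto
  obtain B where B: "\<And>t. t \<ge> 0 \<Longrightarrow> norm (P t) \<le> B"
  proof -
    have "\<forall>\<^sub>F t in at_top. dist (P t) L < 1" using limP by (rule tendstoD) simp
    then obtain T where T: "\<And>t. t \<ge> T \<Longrightarrow> dist (P t) L < 1" by (auto simp: eventually_at_top_linorder)
    have "bounded (P ` {0..T})"
      by (intro compact_imp_bounded compact_continuous_image contP') auto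
    then obtain B1 where B1: "\<And>t. t \<in> {0..T} \<Longrightarrow> norm (P t) \<le> B1" by (fastforce simp: bounded_iff)
    show ?thesis
    proof (rule that[of "max B1 (norm L + 1)"])
      fix t :: real assume t: "t \<ge> 0"
      show "norm (P t) \<le> max B1 (norm L + 1)"
      proof (cases "t \<le> T")
        case False
        then have "norm (P t - L) < 1" using T[of t] by (simp add: dist_norm)
        then show ?thesis using norm_triangle_sub[of "P t" L] by linarith
      qed (use B1 t in force)
    qed
  qed
  have B0: "B \<ge> 0" by (rule order_trans[OF norm_ge_zero B[of 0]]) simp
  have eq: "(LINT t|lborel. gauss_weight R t *\<^sub>R \<phi> t) =
      (LINT u|lborel. indicator {0<..} u *\<^sub>R ((u * gauss_weight 1 u) *\<^sub>R P (R * u)))" if R: "R > 0" for R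
  proof -
    define A where "A = (\<lambda>t. gauss_weight R t *\<^sub>R (\<phi> t + \<phi> (- t)))"
    define D where "D = (\<lambda>t. (t / R\<^sup>2 * gauss_weight R t) *\<^sub>R P t)"
    have int1: "set_integrable lborel {0<..} (\<lambda>t. gauss_weight R t *\<^sub>R \<phi> t)"
      using int[OF R] unfolding set_integrable_def by (intro integrable_mult_indicator) auto
    have int2: "set_integrable lborel {0<..} (\<lambda>t. gauss_weight R t *\<^sub>R \<phi> (- t))"
      using lborel_integrable_real_affine[OF int[OF R], of "-1" 0]
      unfolding set_integrable_def by (intro integrable_mult_indicator) (auto simp: gauss_weight_minus)
    have intA: "set_integrable lborel {0<..} A"
      using set_integral_add(1)[OF int1 int2] by (simp add: A_def scaleR_add_right)
    have intD: "set_integrable lborel {0<..} D"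
      unfolding set_integrable_def
    proof (rule Bochner_Integration.integrable_bound)
      show "integrable lborel (\<lambda>t. B / R\<^sup>2 * (gauss_weight R t * \<bar>t\<bar> ^ 1))"
        by (intro integrable_mult_right integrable_gauss_weight_moment R)
      show "AE t in lborel. norm (indicator {0<..} t *\<^sub>R D t) \<le> norm (B / R\<^sup>2 * (gauss_weight R t * \<bar>t\<bar> ^ 1))"
      proof (rule always_eventually, rule allI)
        fix t
        show "norm (indicator {0<..} t *\<^sub>R D t) \<le> norm (B / R\<^sup>2 * (gauss_weight R t * \<bar>t\<bar> ^ 1))"
        proof (cases "t > 0")
          case True
          have "norm (D t) = (t / R\<^sup>2 * gauss_weight R t) * norm (P t)"
            using True gauss_weight_pos[of R t] by (simp add: D_def abs_mult)
          also have "\<dots> \<le> (t / R\<^sup>2 * gauss_weight R t) * B"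
            using True gauss_weight_pos[of R t] B[of t] by (intro mult_left_mono) auto
          finally show ?thesis using True gauss_weight_pos[of R t] B0 by (simp add: mult_ac abs_mult)
        qed simp
      qed
      show "(\<lambda>t. indicator {0<..} t *\<^sub>R D t) \<in> borel_measurable lborel"
        unfolding D_def by measurable
    qed
    \<comment> \<open>The integrand is the derivative of
      \<open>gauss_weight R t *\<^sub>R P t\<close>, which vanishes at 0 because
      \<open>P 0 = 0\<close> and at infinity because the weight decays and \<open>P\<close>
      converges.\<close>
    have "(LBINT t=0..\<infinity>. A t - D t) = 0 - 0"
    proof (rule interval_integral_FTC_integrable[where F = "\<lambda>t. gauss_weight R t *\<^sub>R P t"])
      fix t :: real
      have "((\<lambda>t. gauss_weight R t *\<^sub>R P t) has_vector_derivative
          (gauss_weight R t *\<^sub>R (\<phi> t + \<phi> (- t)) + (- (t / R\<^sup>2 * gauss_weight R t)) *\<^sub>R P t)) (at t)"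
        by (intro has_vector_derivative_scaleR has_real_derivative_gauss_weight R P')
      then show "((\<lambda>t. gauss_weight R t *\<^sub>R P t) has_vector_derivative A t - D t) (at t)"
        by (simp add: A_def D_def)
      have "isCont (\<lambda>t. \<phi> (- t)) t"
        by (rule isCont_o2[where f = uminus]) (auto intro!: cont continuous_intros)
      then show "isCont (\<lambda>t. A t - D t) t"
        unfolding A_def D_def gauss_weight_def using R by (intro continuous_intros cont contP) auto
    next
      show "set_integrable lborel (einterval 0 \<infinity>) (\<lambda>t. A t - D t)"
        using set_integral_diff(1)[OF intA intD] by (simp add: zero_ereal_def)
      have "isCont (\<lambda>t. gauss_weight R t *\<^sub>R P t) 0"
        unfolding gauss_weight_def using R by (intro continuous_intros contP) auto
      then have "((\<lambda>t. gauss_weight R t *\<^sub>R P t) \<longlongrightarrow> 0) (at 0)"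
        using P0 by (simp add: isCont_def)
      then show "(((\<lambda>t. gauss_weight R t *\<^sub>R P t) \<circ> real_of_ereal) \<longlongrightarrow> 0) (at_right 0)"
        unfolding zero_ereal_def ereal_tendsto_simps by (rule filterlim_mono) (auto simp: at_le)
      show "(((\<lambda>t. gauss_weight R t *\<^sub>R P t) \<circ> real_of_ereal) \<longlongrightarrow> 0) (at_left \<infinity>)"
        unfolding ereal_tendsto_simps using tendsto_scaleR[OF gauss_weight_tendsto_0[OF R] limP] by simp
    qed auto
    then have "(LINT t:{0<..}|lborel. A t) = (LINT t:{0<..}|lborel. D t)"
      using set_integral_diff(2)[OF intA intD] by (simp add: interval_lebesgue_integral_0_infty)
    \<comment> \<open>The substitution \<open>t = R * u\<close> makes the density independent of
      \<open>R\<close>, which then survives only in the argument of \<open>P\<close>.\<close>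
    also have "(LINT t:{0<..}|lborel. D t) =
        (LINT u|lborel. indicator {0<..} u *\<^sub>R ((u * gauss_weight 1 u) *\<^sub>R P (R * u)))"
      unfolding set_lebesgue_integral_def
      using R by (subst lborel_integral_real_affine[where c = R and t = 0])
         (auto simp: D_def gauss_weight_def power2_eq_square zero_less_mult_iff
            simp flip: integral_scaleR_right intro!: Bochner_Integration.integral_cong split: split_indicator)
    also have "(LINT t:{0<..}|lborel. A t) = (LINT t|lborel. gauss_weight R t *\<^sub>R \<phi> t)"
    proof -
      have int3: "set_integrable lborel {..0} (\<lambda>t. gauss_weight R t *\<^sub>R \<phi> t)"
        using int[OF R] unfolding set_integrable_def by (intro integrable_mult_indicator) auto
      have "(LINT t:{0<..}|lborel. A t) = (LINT t:{0<..}|lborel. gauss_weight R t *\<^sub>R \<phi> t) +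
          (LINT t:{0<..}|lborel. gauss_weight R t *\<^sub>R \<phi> (- t))"
        using set_integral_add(2)[OF int1 int2] by (simp add: A_def scaleR_add_right)
      also have "(LINT t:{0<..}|lborel. gauss_weight R t *\<^sub>R \<phi> (- t)) =
           (LINT t:{..<0}|lborel. gauss_weight R t *\<^sub>R \<phi> t)"
        unfolding set_lebesgue_integral_def
        by (subst lborel_integral_real_affine[where c = "-1" and t = 0])
           (auto simp: gauss_weight_minus intro!: Bochner_Integration.integral_cong split: split_indicator)
      also have "\<dots> = (LINT t:{..0}|lborel. gauss_weight R t *\<^sub>R \<phi> t)"
        unfolding set_lebesgue_integral_def
        using AE_lborel_singleton[of "0::real"]
        by (intro integral_cong_AE, measurable) (auto elim!: eventually_mono split: split_indicator)
      also have "(LINT t:{0<..}|lborel. gauss_weight R t *\<^sub>R \<phi> t) + \<dots> =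
          (LINT t:({0<..} \<union> {..0})|lborel. gauss_weight R t *\<^sub>R \<phi> t)"
        by (rule set_integral_Un[symmetric, OF _ int1 int3]) auto
      also have "{0<..} \<union> {..0} = (UNIV :: real set)" by auto
      finally show ?thesis by (simp add: set_lebesgue_integral_def)
    qed
    finally show ?thesis .
  qed
  \<comment> \<open>For fixed \<open>u > 0\<close> the argument of \<open>P\<close> tends to
    infinity, so \<open>P\<close> tends to \<open>L\<close> under the integral; the bound
    \<open>B\<close> times the density dominates.\<close>
  have "(\<lambda>j. LINT u|lborel. indicator {0<..} u *\<^sub>R ((u * gauss_weight 1 u) *\<^sub>R P (real (Suc j) * u)))
      \<longlonglongrightarrow> (LINT u|lborel. indicator {0<..} u *\<^sub>R ((u * gauss_weight 1 u) *\<^sub>R L))"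
  proof (rule integral_dominated_convergence[where w = "\<lambda>u. B * (gauss_weight 1 u * \<bar>u\<bar> ^ 1)"])
    show "integrable lborel (\<lambda>u. B * (gauss_weight 1 u * \<bar>u\<bar> ^ 1))"
      by (intro integrable_mult_right integrable_gauss_weight_moment) auto
    show "AE u in lborel. (\<lambda>j. indicator {0<..} u *\<^sub>R ((u * gauss_weight 1 u) *\<^sub>R P (real (Suc j) * u)))
       \<longlonglongrightarrow> indicator {0<..} u *\<^sub>R ((u * gauss_weight 1 u) *\<^sub>R L)"
    proof (rule always_eventually, rule allI)
      fix u :: real
      show "(\<lambda>j. indicator {0<..} u *\<^sub>R ((u * gauss_weight 1 u) *\<^sub>R P (real (Suc j) * u)))
       \<longlonglongrightarrow> indicator {0<..} u *\<^sub>R ((u * gauss_weight 1 u) *\<^sub>R L)"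
      proof (cases "u > 0")
        case True
        then have "filterlim (\<lambda>j. real (Suc j) * u) at_top sequentially" by real_asymp
        from filterlim_compose[OF limP this] show ?thesis by (intro tendsto_intros)
      qed simp
    qed
    show "AE u in lborel. norm (indicator {0<..} u *\<^sub>R ((u * gauss_weight 1 u) *\<^sub>R P (real (Suc j) * u)))
       \<le> B * (gauss_weight 1 u * \<bar>u\<bar> ^ 1)" for j
    proof (rule always_eventually, rule allI)
      fix u :: real
      show "norm (indicator {0<..} u *\<^sub>R ((u * gauss_weight 1 u) *\<^sub>R P (real (Suc j) * u)))
       \<le> B * (gauss_weight 1 u * \<bar>u\<bar> ^ 1)"
      proof (cases "u > 0")
        case True
        then have "(u * gauss_weight 1 u) * norm (P (real (Suc j) * u)) \<le> (u * gauss_weight 1 u) * B"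
          using gauss_weight_pos[of 1 u] B[of "real (Suc j) * u"] by (intro mult_left_mono) auto
        then show ?thesis using True gauss_weight_pos[of 1 u] by (simp add: abs_mult mult_ac)
      next
        case False
        have "0 \<le> B * (gauss_weight 1 u * \<bar>u\<bar> ^ 1)"
          using B0 gauss_weight_pos[of 1 u] by (intro mult_nonneg_nonneg) auto
        then show ?thesis using False by simp
      qed
    qed
  qed measurable
  also have "(LINT u|lborel. indicator {0<..} u *\<^sub>R ((u * gauss_weight 1 u) *\<^sub>R L)) =
      (LINT u:{0<..}|lborel. u * gauss_weight 1 u) *\<^sub>R L"
    unfolding set_lebesgue_integral_def scaleR_scaleR by (subst integral_scaleR_left[symmetric])
       (use integrable_mult_indicator[OF _ integrable_gauss_weight_moment[of 1 1], of "{0<..}"] in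
         \<open>auto elim!: Bochner_Integration.integrable_cong[THEN iffD1, rotated -1] split: split_indicator\<close>)
  also have "\<dots> = L" unfolding integral_gauss_weight_first_moment by simp
  finally show ?thesis unfolding eq[OF of_nat_0_less_iff[THEN iffD2, OF zero_less_Suc]] .
qed

section \<open>Mellin transforms on a vertical line\<close>

lemma integrable_exp_abs:
  fixes \<kappa> :: real
  assumes "\<kappa> > 0"
  shows "integrable lborel (\<lambda>u. exp (- \<kappa> * \<bar>u\<bar>))"
proof -
  define h :: "real \<Rightarrow> real" where "h = (\<lambda>u. exp (- u) * indicator {0..} u)"
  have h: "integrable lborel h"
    using has_bochner_integral_I0i_power_exp_m'[of 0] by (auto simp: has_bochner_integral_iff h_def)
  have "integrable lborel (\<lambda>u. h (0 + \<kappa> * u) + h (0 + (- \<kappa>) * u))"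
    using assms by (intro Bochner_Integration.integrable_add lborel_integrable_real_affine h) auto
  then show ?thesis
  proof (rule Bochner_Integration.integrable_bound)
    show "AE u in lborel. norm (exp (- \<kappa> * \<bar>u\<bar>)) \<le> norm (h (0 + \<kappa> * u) + h (0 + (- \<kappa>) * u))"
      using assms by (intro always_eventually allI)
        (auto simp: h_def zero_le_mult_iff mult_le_0_iff abs_if split: split_indicator)
  qed measurable
qed

text \<open>The constant bound governs the integrand near 0 and the power bound governs it near
  infinity, so the Mellin integral converges absolutely for real parts between 0 and \<beta>. The
  locale serves both \<open>f\<close> and its running mean, the latter with \<beta> equal to
  1.\<close>

locale mellin_strip =
  fixes g :: "real \<Rightarrow> complex" and C \<beta> c :: real
  assumes cont: "continuous_on {0<..} g"
    and bound_const: "\<And>v. v > 0 \<Longrightarrow> norm (g v) \<le> C"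
    and bound_powr: "\<And>v. v > 0 \<Longrightarrow> norm (g v) \<le> C * v powr (- \<beta>)"
    and strip: "0 < c" "c < \<beta>"
begin

lemma C_nonneg: "C \<ge> 0"
  using order_trans[OF norm_ge_zero bound_const[of 1]] by simp

lemma continuous_on_exp: "y > 0 \<Longrightarrow> continuous_on UNIV (\<lambda>u. g (y * exp u))"
  by (rule continuous_on_compose2[OF cont]) (auto intro!: continuous_intros)

lemma borel_measurable_exp: "y > 0 \<Longrightarrow> (\<lambda>u. g (y * exp u)) \<in> borel_measurable borel"
  by (intro borel_measurable_continuous_onI continuous_on_exp)

lemma integrable_exp: "integrable lborel (\<lambda>u. exp (Complex c t * of_real u) * g (exp u))"
proof (rule Bochner_Integration.integrable_bound)
  \<comment> \<open>The distance from \<open>c\<close> to the boundary of the strip is the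
    exponential decay rate of the integrand in the variable \<open>u = ln x\<close>.\<close>
  define \<kappa> where "\<kappa> = min c (\<beta> - c)"
  have \<kappa>: "\<kappa> > 0" "\<kappa> \<le> c" "\<kappa> \<le> \<beta> - c" using strip by (auto simp: \<kappa>_def)
  show "integrable lborel (\<lambda>u. C * exp (- \<kappa> * \<bar>u\<bar>))"
    by (intro integrable_mult_right integrable_exp_abs \<kappa>)
  show "(\<lambda>u. exp (Complex c t * of_real u) * g (exp u)) \<in> borel_measurable lborel"
    using borel_measurable_exp[of 1] by simp
  show "AE u in lborel. norm (exp (Complex c t * of_real u) * g (exp u)) \<le> norm (C * exp (- \<kappa> * \<bar>u\<bar>))"
  proof (rule always_eventually, rule allI)
    fix u :: real
    have eq: "norm (exp (Complex c t * of_real u) * g (exp u)) = exp (c * u) * norm (g (exp u))"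
      by (simp add: norm_mult)
    show "norm (exp (Complex c t * of_real u) * g (exp u)) \<le> norm (C * exp (- \<kappa> * \<bar>u\<bar>))"
    proof (cases "u \<ge> 0")
      case True
      have "exp (c * u) * norm (g (exp u)) \<le> exp (c * u) * (C * exp (- (\<beta> * u)))"
        using bound_powr[of "exp u"] by (intro mult_left_mono) (auto simp: powr_def)
      also have "\<dots> = C * exp ((c - \<beta>) * u)" by (simp add: exp_diff exp_minus left_diff_distrib field_simps)
      also have "\<dots> \<le> C * exp (- \<kappa> * u)"
      proof -
        have "(c - \<beta>) * u \<le> - \<kappa> * u" by (intro mult_right_mono) (use \<kappa> True in auto)
        then show ?thesis using C_nonneg by (intro mult_left_mono) auto
      qed
      finally show ?thesis using True C_nonneg by (simp add: eq)
    next
      case False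
      have "exp (c * u) * norm (g (exp u)) \<le> exp (c * u) * C"
        using bound_const[of "exp u"] by (intro mult_left_mono) auto
      also have "\<dots> = C * exp (c * u)" by simp
      also have "\<dots> \<le> C * exp (\<kappa> * u)"
        using C_nonneg \<kappa> False by (intro mult_left_mono) (auto intro!: mult_right_mono_neg)
      finally show ?thesis using False C_nonneg by (simp add: eq)
    qed
  qed
qed

text \<open>The substitution \<open>x = exp u\<close> turns the Mellin transform on the line into a
  Fourier integral in \<open>t\<close>, so that Gaussian Fourier analysis becomes available.\<close>

lemma mellin_exp: "mellin g (Complex c t) = (LINT u|lborel. exp (Complex c t * of_real u) * g (exp u))"
proof -
  let ?s = "Complex c t"
  let ?h = "\<lambda>x. of_real x powr (?s - 1) * g x"
  have eq: "\<bar>exp u\<bar> *\<^sub>R ?h (exp u) = exp (?s * of_real u) * g (exp u)" for u :: real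
  proof -
    have "of_real (exp u) powr (?s - 1) = exp ((?s - 1) * of_real u)"
      by (simp add: powr_def Ln_of_real del: of_real_exp)
    moreover have "exp (of_real u) * exp ((?s - 1) * of_real u) = exp (?s * of_real u)"
      by (subst exp_add[symmetric]) (simp add: algebra_simps)
    ultimately show ?thesis
      by (simp add: scaleR_conv_of_real flip: exp_of_real)
  qed
  have img: "exp ` UNIV = {0::real<..}"
    by (auto simp: image_iff intro: exp_total elim: exp_ln[symmetric])
  \<comment> \<open>The change of variables is carried out for the completed measure; continuity of
    the Mellin integrand on the positive half-line supplies the Borel measurability for the way
    back.\<close>
  have "integrable lebesgue (\<lambda>u. exp (?s * of_real u) * g (exp u))"
    using integrable_exp[of t] by (subst integrable_completion) auto
  then have "(\<lambda>u. exp (?s * of_real u) * g (exp u)) absolutely_integrable_on UNIV"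
    by (simp add: set_integrable_def)
  moreover have "integral UNIV (\<lambda>u. exp (?s * of_real u) * g (exp u)) =
      (LINT u|lborel. exp (?s * of_real u) * g (exp u))"
    using set_borel_integral_eq_integral(2)[of UNIV "\<lambda>u. exp (?s * of_real u) * g (exp u)"] integrable_exp[of t]
    by (simp add: set_integrable_def set_lebesgue_integral_def)
  moreover have "(\<lambda>u. \<bar>exp u\<bar> *\<^sub>R ?h (exp u)) absolutely_integrable_on UNIV \<and>
        integral UNIV (\<lambda>u. \<bar>exp u\<bar> *\<^sub>R ?h (exp u)) = b
      \<longleftrightarrow> ?h absolutely_integrable_on exp ` UNIV \<and> integral (exp ` UNIV) ?h = b" for b
    by (rule has_absolute_integral_change_of_variables_real) (auto intro!: derivative_eq_intros simp: inj_on_def)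
  ultimately have *: "?h absolutely_integrable_on {0<..}"
      "integral {0<..} ?h = (LINT u|lborel. exp (?s * of_real u) * g (exp u))"
    unfolding eq img by blast+
  have "continuous_on {0<..} ?h"
    by (intro continuous_intros cont) (auto simp: complex_nonpos_Reals_iff)
  then have "(\<lambda>x. indicator {0<..} x *\<^sub>R ?h x) \<in> borel_measurable borel"
    by (intro borel_measurable_continuous_on_indicator) auto
  then have "set_integrable lborel {0<..} ?h"
    using *(1) by (simp add: set_integrable_def integrable_completion)
  from set_borel_integral_eq_integral(2)[OF this] show ?thesis
    using *(2) by (simp add: mellin_def)
qed

text \<open>Scaling the argument by \<open>y\<close> is a translation of \<open>u\<close> by
  \<open>ln y\<close>, under which the exponential picks up the factor
  \<open>y powr s\<close>.\<close>

lemma mellin_scale: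
  assumes y: "y > 0"
  shows "of_real y powr (- Complex c t) * mellin g (Complex c t) =
           (LINT u|lborel. exp (Complex c t * of_real u) * g (y * exp u))"
    and "integrable lborel (\<lambda>u. exp (Complex c t * of_real u) * g (y * exp u))"
proof -
  let ?s = "Complex c t"
  have eq: "exp (?s * of_real (ln y + 1 * u)) * g (exp (ln y + 1 * u)) =
      exp (?s * of_real (ln y)) * (exp (?s * of_real u) * g (y * exp u))" for u
    using y by (simp add: exp_add distrib_left)
  have p: "of_real y powr (- ?s) = exp (- (?s * of_real (ln y)))"
    using y by (simp add: powr_def Ln_of_real)
  have "mellin g ?s = exp (?s * of_real (ln y)) * (LINT u|lborel. exp (?s * of_real u) * g (y * exp u))"
    unfolding mellin_exp by (subst lborel_integral_real_affine[where c = 1 and t = "ln y"]) (simp_all only: eq, simp_all)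
  then show "of_real y powr (- ?s) * mellin g ?s = (LINT u|lborel. exp (?s * of_real u) * g (y * exp u))"
    unfolding p by (simp add: exp_minus)
  have "integrable lborel (\<lambda>u. exp (?s * of_real (ln y)) * (exp (?s * of_real u) * g (y * exp u)))"
    using lborel_integrable_real_affine[OF integrable_exp[of t], of 1 "ln y"] unfolding eq by simp
  from integrable_mult_right[OF this, of "exp (- (?s * of_real (ln y)))"]
  show "integrable lborel (\<lambda>u. exp (?s * of_real u) * g (y * exp u))"
    by (simp add: exp_minus field_simps)
qed

lemma mellin_bound: "norm (mellin g (Complex c t)) \<le> (LINT u|lborel. exp (c * u) * norm (g (exp u)))"
  unfolding mellin_exp using integral_norm_bound[of lborel "\<lambda>u. exp (Complex c t * of_real u) * g (exp u)"]
  by (simp add: norm_mult)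

text \<open>The modulus of the integrand does not depend on \<open>t\<close>, so the integrand at
  \<open>t = 0\<close> supplies the majorant for dominated convergence.\<close>

lemma isCont_mellin: "isCont (\<lambda>t. mellin g (Complex c t)) t"
proof (subst continuous_at_sequentially, intro allI impI)
  fix X :: "nat \<Rightarrow> real" assume X: "X \<longlonglongrightarrow> t"
  have [measurable]: "(\<lambda>u. g (exp u)) \<in> borel_measurable borel"
    using borel_measurable_exp[of 1] by simp
  have "(\<lambda>n. LINT u|lborel. exp (Complex c (X n) * of_real u) * g (exp u)) \<longlonglongrightarrow>
      (LINT u|lborel. exp (Complex c t * of_real u) * g (exp u))"
  proof (rule integral_dominated_convergence)
    show "integrable lborel (\<lambda>u. norm (exp (Complex c 0 * of_real u) * g (exp u)))"
      by (intro integrable_norm integrable_exp)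
    show "AE u in lborel. (\<lambda>n. exp (Complex c (X n) * of_real u) * g (exp u)) \<longlonglongrightarrow>
        exp (Complex c t * of_real u) * g (exp u)"
      by (intro always_eventually allI tendsto_intros X)
  qed (auto simp: norm_mult)
  then show "((\<lambda>t. mellin g (Complex c t)) \<circ> X) \<longlonglongrightarrow> mellin g (Complex c t)"
    by (simp add: mellin_exp o_def)
qed

end

section \<open>Gaussian-weighted Mellin inversion\<close>

lemma integral_gauss_weight_iexp:
  assumes R: "R > 0"
  shows "(LINT t|lborel. gauss_weight R t *\<^sub>R iexp (t * u)) = of_real (2 * pi * R * std_normal_density (R * u))"
proof -
  have s: "sqrt 2 * sqrt 2 = (2::real)" "sqrt pi * sqrt pi = pi" by simp_all
  have gw: "gauss_weight R (0 + R * x) *\<^sub>R iexp ((0 + R * x) * u) =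
      sqrt (2 * pi) *\<^sub>R (std_normal_density x *\<^sub>R iexp ((R * u) * x))" for x
    using R by (simp add: gauss_weight_def std_normal_density_def mult_ac)
  have "(LINT t|lborel. gauss_weight R t *\<^sub>R iexp (t * u)) =
      R *\<^sub>R (LINT x|lborel. sqrt (2 * pi) *\<^sub>R (std_normal_density x *\<^sub>R iexp ((R * u) * x)))"
    using R by (subst lborel_integral_real_affine[where c = R and t = 0]) (simp_all only: gw, simp_all)
  also have "\<dots> = (R * sqrt (2 * pi)) *\<^sub>R (LINT x|lborel. std_normal_density x *\<^sub>R iexp ((R * u) * x))"
    by (subst integral_scaleR_right) (simp only: scaleR_scaleR)
  \<comment> \<open>After \<open>t = R * x\<close> the Fourier transform of the weight is the
    characteristic function of the standard normal distribution at \<open>R * u\<close>.\<close>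
  also have "(LINT x|lborel. std_normal_density x *\<^sub>R iexp ((R * u) * x)) = char std_normal_distribution (R * u)"
    unfolding char_def by (subst integral_density) auto
  also have "\<dots> = of_real (exp (- (R * u)\<^sup>2 / 2))"
    unfolding char_std_normal_distribution ..
  also have "(R * sqrt (2 * pi)) *\<^sub>R of_real (exp (- (R * u)\<^sup>2 / 2)) =
      complex_of_real (2 * pi * R * std_normal_density (R * u))"
    unfolding std_normal_density_def scaleR_conv_of_real of_real_mult[symmetric]
    by (rule arg_cong[where f = of_real]) (simp add: real_sqrt_mult field_simps s)
  finally show ?thesis .
qed

text \<open>The log-normal points \<open>y * exp (z / R)\<close> concentrate at \<open>y\<close> as
  \<open>R\<close> grows, and the tilt by \<open>exp (c * z / R)\<close> tends to 1. Keeping the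
  density in \<open>z\<close> free of \<open>R\<close> leaves a single integrable majorant for all
  \<open>R \<ge> 1\<close>.\<close>

definition mellin_smooth :: "real \<Rightarrow> real \<Rightarrow> (real \<Rightarrow> complex) \<Rightarrow> real \<Rightarrow> complex" where
  "mellin_smooth c R g y =
     (LINT z|lborel. std_normal_density z *\<^sub>R (of_real (exp (c * z / R)) * g (y * exp (z / R))))"

context mellin_strip
begin

text \<open>The weight makes the double integral over \<open>t\<close> and \<open>u\<close>
  absolutely convergent. By Fubini, integrating over \<open>t\<close> first leaves a Gaussian in
  \<open>u\<close> of width \<open>1 / R\<close>, and \<open>u = z / R\<close> normalises
  it.\<close>

lemma integral_gauss_weight_mellin:
  assumes R: "R > 0" and y: "y > 0"
  shows "(LINT t|lborel. gauss_weight R t *\<^sub>R (of_real y powr (- Complex c t) * mellin g (Complex c t))) =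
           of_real (2 * pi) * mellin_smooth c R g y"
proof -
  define q where "q = (\<lambda>u. of_real (exp (c * u)) * g (y * exp u))"
  have q: "integrable lborel q"
    using mellin_scale(2)[OF y, of 0] by (simp add: q_def complex_of_real_def[symmetric] exp_of_real[symmetric] flip: of_real_mult)
  have [measurable]: "q \<in> borel_measurable borel"
    using borel_measurable_integrable[OF q] by simp
  have split: "exp (Complex c t * of_real u) * g (y * exp u) = iexp (t * u) * q u" for t u
  proof -
    have "Complex c t * of_real u = of_real (c * u) + \<i> * of_real (t * u)" by (simp add: complex_eq_iff)
    then have "exp (Complex c t * of_real u) = of_real (exp (c * u)) * iexp (t * u)"
      by (simp only: exp_add exp_of_real)
    then show ?thesis by (simp only: q_def mult_ac)
  qed
  define F where "F = (\<lambda>t u. gauss_weight R t *\<^sub>R (iexp (t * u) * q u))"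
  have Fint: "integrable (lborel \<Otimes>\<^sub>M lborel) (case_prod F)"
  proof (rule lborel_pair.Fubini_integrable)
    show "case_prod F \<in> borel_measurable (lborel \<Otimes>\<^sub>M lborel)"
      unfolding F_def by measurable
    have "(LINT u|lborel. norm (case_prod F (t, u))) = gauss_weight R t * (LINT u|lborel. norm (q u))" for t
      using gauss_weight_pos[of R t] by (simp add: F_def norm_mult)
    then show "integrable lborel (\<lambda>t. LINT u|lborel. norm (case_prod F (t, u)))"
      using integrable_gauss_weight_moment[OF R, of 0] by simp
    show "AE t in lborel. integrable lborel (\<lambda>u. case_prod F (t, u))"
      using mellin_scale(2)[OF y] by (simp add: F_def split)
  qed
  have "(LINT t|lborel. gauss_weight R t *\<^sub>R (of_real y powr (- Complex c t) * mellin g (Complex c t))) =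
      (LINT t|lborel. LINT u|lborel. F t u)"
    unfolding mellin_scale(1)[OF y] split F_def by simp
  also have "\<dots> = (LINT u|lborel. LINT t|lborel. F t u)"
    by (rule lborel_pair.Fubini_integral[OF Fint, symmetric])
  also have "\<dots> = (LINT u|lborel. of_real (2 * pi * R * std_normal_density (R * u)) * q u)"
  proof -
    have "(LINT t|lborel. F t u) = of_real (2 * pi * R * std_normal_density (R * u)) * q u" for u
    proof -
      have "(LINT t|lborel. F t u) = (LINT t|lborel. (gauss_weight R t *\<^sub>R iexp (t * u)) * q u)"
        by (simp add: F_def)
      then show ?thesis unfolding integral_mult_left_zero integral_gauss_weight_iexp[OF R] .
    qed
    then show ?thesis by simp
  qed
  also have "\<dots> = of_real (2 * pi) * mellin_smooth c R g y"
  proof -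
    have eq: "(1 / R) *\<^sub>R (of_real (2 * pi * R * std_normal_density (R * (0 + 1 / R * z))) * q (0 + 1 / R * z)) =
        of_real (2 * pi) * (std_normal_density z *\<^sub>R (of_real (exp (c * z / R)) * g (y * exp (z / R))))" for z
      using R by (simp add: q_def scaleR_conv_of_real)
    have "(LINT u|lborel. of_real (2 * pi * R * std_normal_density (R * u)) * q u) = \<bar>1 / R\<bar> *\<^sub>R
        (LINT z|lborel. of_real (2 * pi * R * std_normal_density (R * (0 + 1 / R * z))) * q (0 + 1 / R * z))"
      by (rule lborel_integral_real_affine) (use R in simp)
    also have "\<bar>1 / R\<bar> = 1 / R" using R by simp
    also have "(1 / R) *\<^sub>R
        (LINT z|lborel. of_real (2 * pi * R * std_normal_density (R * (0 + 1 / R * z))) * q (0 + 1 / R * z)) =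
        (LINT z|lborel. of_real (2 * pi) *
          (std_normal_density z *\<^sub>R (of_real (exp (c * z / R)) * g (y * exp (z / R)))))"
      unfolding eq[symmetric] by (rule integral_scaleR_right[symmetric])
    also have "\<dots> = of_real (2 * pi) * mellin_smooth c R g y"
      unfolding mellin_smooth_def by (rule integral_mult_right_zero)
    finally show ?thesis .
  qed
  finally show ?thesis .
qed

end

section \<open>Partial sums for the zeta function in the critical strip\<close>

text \<open>A partial sum of the zeta series with its leading Euler-Maclaurin correction, which
  cancels the growth of the partial sums when the real part lies between 0 and 1. Evaluating the
  correction at \<open>Suc N\<close> makes the sum of the remainders \<open>zeta_rem 1\<close>
  telescope to it exactly.\<close>

definition zeta_approx :: "nat \<Rightarrow> complex \<Rightarrow> complex" where
  "zeta_approx N s = (\<Sum>n<N. of_nat (Suc n) powr (- s)) - of_nat (Suc N) powr (1 - s) / (1 - s)"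

lemma zeta_rem_1:
  "zeta_rem 1 n s = of_nat (Suc (Suc n)) powr (1 - s) - of_nat (Suc n) powr (1 - s)
     + (s - 1) * of_nat (Suc n) powr (- s)"
  by (simp add: zeta_rem_def algebra_simps)

lemma zeta_approx_eq:
  assumes "s \<noteq> 1"
  shows "zeta_approx N s = (1 + (\<Sum>n<N. zeta_rem 1 n s)) / (s - 1)"
proof -
  have "1 + (\<Sum>n<N. zeta_rem 1 n s) =
      of_nat (Suc N) powr (1 - s) + (s - 1) * (\<Sum>n<N. of_nat (Suc n) powr (- s))"
  proof (induction N)
    case (Suc N)
    have "1 + (\<Sum>n<Suc N. zeta_rem 1 n s) = (1 + (\<Sum>n<N. zeta_rem 1 n s)) + zeta_rem 1 N s" by simp
    also have "\<dots> = of_nat (Suc (Suc N)) powr (1 - s) + (s - 1) * (\<Sum>n<Suc N. of_nat (Suc n) powr (- s))"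
      unfolding Suc by (simp add: zeta_rem_1 distrib_left del: One_nat_def)
    finally show ?case .
  qed simp
  moreover have "of_nat (Suc N) powr (1 - s) / (1 - s) = - (of_nat (Suc N) powr (1 - s) / (s - 1))"
    using minus_divide_right[of "of_nat (Suc N) powr (1 - s)" "s - 1"] by simp
  ultimately show ?thesis using assms by (simp only: zeta_approx_def add_divide_distrib) simp
qed

text \<open>For real part above 1 this is \<open>zeta_recursion\<close> with \<open>N = 1\<close>.
  Both sides are holomorphic on the right half-plane without the point 1, which is connected, so the
  identity extends.\<close>

lemma zeta_eq_zeta_rem_series:
  assumes s: "Re s > 0" "s \<noteq> 1"
  shows "zeta s = (1 + (\<Sum>n. zeta_rem 1 n s)) / (s - 1)"
proof (rule analytic_continuation_open[of "{s. Re s > 1}" "{s. Re s > 0} - {1}" zeta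
      "\<lambda>s. (1 + (\<Sum>n. zeta_rem 1 n s)) / (s - 1)"])
  show "open {s. Re s > 1}" "open ({s. Re s > 0} - {1::complex})"
    by (auto simp: open_halfspace_Re_gt intro!: open_Diff)
  show "{s. Re s > 1} \<noteq> {}" by (auto intro: exI[of _ 2])
  show "connected ({s. Re s > 0} - {1::complex})"
    by (intro connected_open_delete convex_connected convex_halfspace_Re_gt open_halfspace_Re_gt) simp
  show "{s. Re s > 1} \<subseteq> {s. Re s > 0} - {1}" by auto
  show "zeta holomorphic_on {s. Re s > 0} - {1}"
    using is_zeta_zeta unfolding is_zeta_def by (auto intro: holomorphic_on_subset)
  show "(\<lambda>s. (1 + (\<Sum>n. zeta_rem 1 n s)) / (s - 1)) holomorphic_on {s. Re s > 0} - {1}"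
    by (intro holomorphic_intros holomorphic_on_subset[OF zeta_rem_series(1)[of 1]]) auto
  show "zeta z = (1 + (\<Sum>n. zeta_rem 1 n z)) / (z - 1)" if "z \<in> {s. Re s > 1}" for z
  proof -
    have "zeta z = (\<Sum>n. of_nat (Suc n) powr (- z))"
      using is_zeta_zeta that unfolding is_zeta_def by blast
    moreover have "(z - 1) * (\<Sum>n. of_nat (Suc n) powr (- z)) = 1 + (\<Sum>n. zeta_rem 1 n z)"
      using zeta_recursion[of z 1] that by simp
    moreover have "z \<noteq> 1" using that by auto
    ultimately show ?thesis by (simp add: field_simps)
  qed
qed (use s in auto)

lemma zeta_approx_tendsto:
  assumes s: "Re s > 0" "s \<noteq> 1"
  shows "(\<lambda>N. zeta_approx N s) \<longlonglongrightarrow> zeta s"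
  unfolding zeta_approx_eq[OF s(2)] zeta_eq_zeta_rem_series[OF s]
  using s by (intro tendsto_intros summable_LIMSEQ zeta_rem_series(2)) auto

text \<open>The remainder bound carries the factor \<open>(s - 1) * s\<close>; division by
  \<open>s - 1\<close> leaves linear growth in \<open>t\<close>, uniformly in \<open>N\<close>,
  which a Gaussian weight absorbs.\<close>

lemma zeta_approx_bound:
  assumes c: "0 < c" "c < 1"
  shows "norm (zeta_approx N (Complex c t)) \<le>
           1 / (1 - c) + (c + \<bar>t\<bar>) * (\<Sum>n. real (Suc n) powr (- (c + 1)))"
proof -
  let ?s = "Complex c t"
  let ?Z = "\<Sum>n. real (Suc n) powr (- (c + 1))"
  have s1: "?s \<noteq> 1" using c by (auto simp: complex_eq_iff)
  have n1: "norm (?s - 1) \<ge> 1 - c" using abs_Re_le_cmod[of "?s - 1"] c by simp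
  have n2: "norm ?s \<le> c + \<bar>t\<bar>" using cmod_le[of ?s] c by simp
  have sm: "summable (\<lambda>n. real (Suc n) powr (- (c + 1)))" by (rule summable_Suc_powr) (use c in simp)
  have Z0: "?Z \<ge> 0" by (rule suminf_nonneg[OF sm]) simp
  have "norm (\<Sum>n<N. zeta_rem 1 n ?s) \<le> (\<Sum>n<N. norm (?s - 1) * norm ?s * real (Suc n) powr (- (c + 1)))"
  proof (rule sum_norm_le)
    fix n
    have "pochhammer (?s - 1) (Suc 1) = (?s - 1) * ?s"
      by (simp add: pochhammer_Suc)
    then show "norm (zeta_rem 1 n ?s) \<le> norm (?s - 1) * norm ?s * real (Suc n) powr (- (c + 1))"
      using zeta_rem_bound[of 1 ?s n] c by (simp add: norm_mult)
  qed
  also have "\<dots> = norm (?s - 1) * norm ?s * (\<Sum>n<N. real (Suc n) powr (- (c + 1)))"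
    by (simp add: sum_distrib_left)
  also have "\<dots> \<le> norm (?s - 1) * norm ?s * ?Z"
    by (intro mult_left_mono sum_le_suminf sm) auto
  finally have "norm (1 + (\<Sum>n<N. zeta_rem 1 n ?s)) \<le> 1 + norm (?s - 1) * norm ?s * ?Z"
    by (intro order_trans[OF norm_triangle_ineq]) simp
  then have "norm (zeta_approx N ?s) \<le> (1 + norm (?s - 1) * norm ?s * ?Z) / norm (?s - 1)"
    unfolding zeta_approx_eq[OF s1] norm_divide by (intro divide_right_mono) auto
  also have "\<dots> = 1 / norm (?s - 1) + norm ?s * ?Z" using s1 by (simp add: add_divide_distrib)
  also have "\<dots> \<le> 1 / (1 - c) + (c + \<bar>t\<bar>) * ?Z"
    using n1 n2 c Z0 by (intro add_mono mult_right_mono divide_left_mono mult_pos_pos) linarith+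
  finally show ?thesis .
qed

section \<open>Averages against a concentrating normal distribution\<close>

lemma integrable_std_normal_density_exp_abs:
  "integrable lborel (\<lambda>z. std_normal_density z * exp (a * \<bar>z\<bar>))"
proof (rule Bochner_Integration.integrable_bound)
  \<comment> \<open>Completing the square: an exponential tilt of the normal density is a shifted
    normal density up to a constant.\<close>
  have shift: "std_normal_density z * exp (b * z) = exp (b\<^sup>2 / 2) * normal_density b 1 z" for b z
    by (simp add: normal_density_def flip: exp_add) (simp add: power2_eq_square field_simps)
  have "integrable lborel (\<lambda>z. std_normal_density z * exp (b * z))" for b
    unfolding shift by (intro integrable_mult_right integrable_normal_density) simp
  then show "integrable lborel (\<lambda>z. std_normal_density z * exp (a * z) + std_normal_density z * exp ((- a) * z))"
    by (intro Bochner_Integration.integrable_add)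
  show "AE z in lborel. norm (std_normal_density z * exp (a * \<bar>z\<bar>))
      \<le> norm (std_normal_density z * exp (a * z) + std_normal_density z * exp ((- a) * z))"
  proof (rule always_eventually, rule allI)
    fix z
    have "std_normal_density z * exp (a * \<bar>z\<bar>)
        \<le> std_normal_density z * exp (a * z) + std_normal_density z * exp ((- a) * z)"
      by (cases "z \<ge> 0") auto
    then show "norm (std_normal_density z * exp (a * \<bar>z\<bar>))
        \<le> norm (std_normal_density z * exp (a * z) + std_normal_density z * exp ((- a) * z))"
      by simp
  qed
qed measurable

text \<open>For \<open>R \<ge> 1\<close> the inequality
  \<open>\<bar>z / R\<bar> \<le> \<bar>z\<bar>\<close> makes the exponential growth bound uniform in
  \<open>R\<close>, and it is integrable against the normal density. This gives the bound and, by
  domination, the limit.\<close>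

lemma std_normal_average:
  fixes H :: "real \<Rightarrow> complex"
  assumes [measurable]: "H \<in> borel_measurable borel"
    and bound: "\<And>u. norm (H u) \<le> M * exp (a * \<bar>u\<bar>)" and a: "a \<ge> 0"
  shows std_normal_average_bound: "R \<ge> 1 \<Longrightarrow>
      norm (LINT z|lborel. std_normal_density z *\<^sub>R H (z / R)) \<le>
        M * (LINT z|lborel. std_normal_density z * exp (a * \<bar>z\<bar>))" (is "_ \<Longrightarrow> ?B")
    and std_normal_average_tendsto: "isCont H 0 \<Longrightarrow>
      (\<lambda>j. LINT z|lborel. std_normal_density z *\<^sub>R H (z / real (Suc j))) \<longlonglongrightarrow> H 0" (is "_ \<Longrightarrow> ?T")
proof -
  let ?w = "\<lambda>z. M * (std_normal_density z * exp (a * \<bar>z\<bar>))"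
  have M: "M \<ge> 0" using order_trans[OF norm_ge_zero bound[of 0]] by simp
  have w: "integrable lborel ?w"
    by (intro integrable_mult_right integrable_std_normal_density_exp_abs)
  have le: "norm (std_normal_density z *\<^sub>R H (z / R)) \<le> ?w z" if R: "R \<ge> 1" for R z
  proof -
    have "\<bar>z / R\<bar> \<le> \<bar>z\<bar>" using R mult_left_mono[of 1 R "\<bar>z\<bar>"] by (simp add: field_simps)
    then have "M * exp (a * \<bar>z / R\<bar>) \<le> M * exp (a * \<bar>z\<bar>)"
      using M mult_left_mono[OF _ a, of "\<bar>z / R\<bar>" "\<bar>z\<bar>"] by (intro mult_left_mono) auto
    then have "norm (H (z / R)) \<le> M * exp (a * \<bar>z\<bar>)" using bound[of "z / R"] by linarith
    then have "std_normal_density z * norm (H (z / R)) \<le> std_normal_density z * (M * exp (a * \<bar>z\<bar>))"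
      by (intro mult_left_mono) auto
    then show ?thesis by (simp add: mult_ac)
  qed
  show ?B if R: "R \<ge> 1"
  proof -
    have int: "integrable lborel (\<lambda>z. std_normal_density z *\<^sub>R H (z / R))"
      by (rule Bochner_Integration.integrable_bound[OF w])
         (use le[OF R] M in \<open>auto intro: order_trans[OF _ abs_ge_self]\<close>)
    have "norm (LINT z|lborel. std_normal_density z *\<^sub>R H (z / R)) \<le>
        (LINT z|lborel. norm (std_normal_density z *\<^sub>R H (z / R)))"
      by (rule integral_norm_bound)
    also have "\<dots> \<le> (LINT z|lborel. ?w z)"
      by (intro integral_mono integrable_norm int w le R)
    also have "\<dots> = M * (LINT z|lborel. std_normal_density z * exp (a * \<bar>z\<bar>))" by simp
    finally show ?thesis .
  qed
  show ?T if "isCont H 0"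
  proof -
    have "(\<lambda>j. LINT z|lborel. std_normal_density z *\<^sub>R H (z / real (Suc j)))
        \<longlonglongrightarrow> (LINT z|lborel. std_normal_density z *\<^sub>R H 0)"
    proof (rule integral_dominated_convergence[where w = ?w])
      show "AE z in lborel. (\<lambda>j. std_normal_density z *\<^sub>R H (z / real (Suc j))) \<longlonglongrightarrow> std_normal_density z *\<^sub>R H 0"
      proof (intro always_eventually allI tendsto_intros)
        fix z :: real
        have "(\<lambda>j. z / real (Suc j)) \<longlonglongrightarrow> 0" by real_asymp
        then show "(\<lambda>j. H (z / real (Suc j))) \<longlonglongrightarrow> H 0"
          by (rule isCont_tendsto_compose[OF that])
      qed
    qed (use w le in auto)
    then show ?thesis by simp
  qed
qed

lemma (in mellin_strip) integrable_gauss_weight_mellin: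
  assumes R: "R > 0" and y: "y > 0"
  shows "integrable lborel (\<lambda>t. gauss_weight R t *\<^sub>R (of_real y powr (- Complex c t) * mellin g (Complex c t)))"
proof (rule Bochner_Integration.integrable_bound)
  define B where "B = (LINT u|lborel. exp (c * u) * norm (g (exp u)))"
  show "integrable lborel (\<lambda>t. y powr (- c) * B * (gauss_weight R t * \<bar>t\<bar> ^ 0))"
    by (intro integrable_mult_right integrable_gauss_weight_moment R)
  have "isCont (\<lambda>t. of_real y powr (- Complex c t) * mellin g (Complex c t)) t" for t
    using y by (intro continuous_intros isCont_mellin) (auto simp: isCont_def intro!: tendsto_intros)
  then have [measurable]: "(\<lambda>t. of_real y powr (- Complex c t) * mellin g (Complex c t)) \<in> borel_measurable borel"
    by (intro borel_measurable_continuous_onI continuous_at_imp_continuous_on) auto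
  show "(\<lambda>t. gauss_weight R t *\<^sub>R (of_real y powr (- Complex c t) * mellin g (Complex c t))) \<in> borel_measurable lborel"
    by measurable
  show "AE t in lborel. norm (gauss_weight R t *\<^sub>R (of_real y powr (- Complex c t) * mellin g (Complex c t)))
      \<le> norm (y powr (- c) * B * (gauss_weight R t * \<bar>t\<bar> ^ 0))"
  proof (rule always_eventually, rule allI)
    fix t
    have "norm (of_real y powr (- Complex c t) * mellin g (Complex c t)) \<le> y powr (- c) * B"
      using y mellin_bound[of t] by (simp add: norm_mult norm_powr_real_powr B_def mult_left_mono)
    then have "gauss_weight R t * norm (of_real y powr (- Complex c t) * mellin g (Complex c t))
       \<le> gauss_weight R t * (y powr (- c) * B)"
      using gauss_weight_pos[of R t] by (intro mult_left_mono) auto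
    then show "norm (gauss_weight R t *\<^sub>R (of_real y powr (- Complex c t) * mellin g (Complex c t)))
      \<le> norm (y powr (- c) * B * (gauss_weight R t * \<bar>t\<bar> ^ 0))"
      using gauss_weight_pos[of R t] by (simp add: mult_ac order_trans[OF _ abs_ge_self])
  qed
qed

section \<open>The Muentz formula\<close>

text \<open>On the line its Mellin transform is that of \<open>f\<close> divided by
  \<open>1 - s\<close>, so it absorbs the denominator of the correction term in
  \<open>zeta_approx\<close>.\<close>

definition running_mean :: "(real \<Rightarrow> complex) \<Rightarrow> real \<Rightarrow> complex" where
  "running_mean f v = (LINT w:{0..v}|lborel. f w) / of_real v"

locale muntz = mellin_strip f C \<alpha> c for f :: "real \<Rightarrow> complex" and C \<alpha> c :: real +
  assumes isCont: "\<And>x. isCont f x"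
    and integrable: "set_integrable lborel {0..} f"
    and \<alpha>_gt_1: "\<alpha> > 1" and c_less_1: "c < 1"
begin

section \<open>The primitive of \<open>f\<close> and the Mellin transform of its running
  mean\<close>

definition primitive :: "real \<Rightarrow> complex" where
  "primitive v = (LINT w:{0..v}|lborel. f w)"

definition L1_norm :: real where
  "L1_norm = (LINT w:{0..}|lborel. norm (f w))"

lemma continuous_f: "continuous_on A f"
  by (simp add: continuous_at_imp_continuous_on isCont)

lemma set_integrable_f: "set_integrable lborel {a..b} f"
  by (intro borel_integrable_atLeastAtMost' continuous_f)

lemma bound_nonneg: "v \<ge> 0 \<Longrightarrow> norm (f v) \<le> C"
proof (rule tendsto_upperbound[of "\<lambda>v. norm (f v)" _ "at_right v"])
  show "((\<lambda>v. norm (f v)) \<longlongrightarrow> norm (f v)) (at_right v)"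
    using isCont[of v] by (intro tendsto_norm) (auto simp: isCont_def intro: filterlim_mono at_le)
  show "\<forall>\<^sub>F x in at_right v. norm (f x) \<le> C" if "v \<ge> 0"
    using that bound_const by (auto simp: eventually_at_filter)
qed auto

text \<open>The linear bound is the one for small \<open>v\<close>, the constant one for large
  \<open>v\<close>. Divided by \<open>v\<close> they become the two bounds that place the running
  mean in a strip of width 1.\<close>

lemma norm_primitive_le:
  assumes v: "v \<ge> 0"
  shows "norm (primitive v) \<le> C * v" and "norm (primitive v) \<le> L1_norm"
proof -
  have "norm (primitive v) \<le> (LINT w:{0..v}|lborel. norm (f w))"
    unfolding primitive_def by (intro set_integral_norm_bound set_integrable_f)
  also have "\<dots> \<le> (LINT w:{0..v}|lborel. C)"
    by (intro set_integral_mono set_integrable_norm set_integrable_f borel_integrable_atLeastAtMost')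
       (auto simp: bound_nonneg)
  also have "\<dots> = C * v" using v by (simp add: set_lebesgue_integral_def)
  finally show "norm (primitive v) \<le> C * v" .
  have "norm (primitive v) \<le> (LINT w:{0..v}|lborel. norm (f w))"
    unfolding primitive_def by (intro set_integral_norm_bound set_integrable_f)
  also have "\<dots> \<le> L1_norm"
    unfolding L1_norm_def set_lebesgue_integral_def
    using set_integrable_norm[OF set_integrable_f[of 0 v]] set_integrable_norm[OF integrable]
    by (intro integral_mono) (auto simp: set_integrable_def split: split_indicator)
  finally show "norm (primitive v) \<le> L1_norm" .
qed

lemma has_vector_derivative_primitive:
  assumes v: "v > 0"
  shows "(primitive has_vector_derivative f v) (at v)"
proof -
  obtain Q where Q: "\<And>t. (Q has_vector_derivative f t) (at t)"
    using einterval_antiderivative[of "-\<infinity>" \<infinity> f] isCont by auto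
  have eq: "primitive x = Q x - Q 0" if "x \<ge> 0" for x
    unfolding primitive_def set_lebesgue_integral_def using that
    by (intro integral_FTC_atLeastAtMost continuous_f has_vector_derivative_at_within[OF Q])
  have "((\<lambda>x. Q x - Q 0) has_vector_derivative f v) (at v)"
    using has_vector_derivative_diff_const[of Q "Q 0"] Q by (simp add: has_vector_derivative_diff_const)
  then show ?thesis
    by (rule has_vector_derivative_transform_within_open[of _ _ _ "{0<..}"]) (use v eq in auto)
qed

lemma isCont_primitive: "v > 0 \<Longrightarrow> isCont primitive v"
  using has_vector_derivative_continuous[OF has_vector_derivative_primitive] .

lemma primitive_tendsto: "(primitive \<longlongrightarrow> (LINT w:{0..}|lborel. f w)) at_top"
proof -
  have "((\<lambda>v. LINT w|lborel. indicator {..v} w *\<^sub>R (indicator {0..} w *\<^sub>R f w)) \<longlongrightarrow>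
      (LINT w|lborel. indicator {0..} w *\<^sub>R f w)) at_top"
    using integrable by (intro tendsto_integral_at_top) (auto simp: set_integrable_def)
  moreover have "(\<lambda>v. LINT w|lborel. indicator {..v} w *\<^sub>R (indicator {0..} w *\<^sub>R f w)) = primitive"
    unfolding primitive_def set_lebesgue_integral_def
    by (intro ext Bochner_Integration.integral_cong) (auto split: split_indicator)
  ultimately show ?thesis by (simp add: set_lebesgue_integral_def)
qed

lemma running_mean_eq: "running_mean f v = primitive v / of_real v"
  by (simp add: running_mean_def primitive_def)

lemma mellin_strip_running_mean: "mellin_strip (running_mean f) (max C L1_norm) 1 c"
proof
  show "continuous_on {0<..} (running_mean f)"
    unfolding running_mean_eq
    by (intro continuous_intros continuous_at_imp_continuous_on ballI isCont_primitive) auto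
  fix v :: real assume v: "v > 0"
  have "norm (running_mean f v) = norm (primitive v) / v"
    using v by (simp add: running_mean_eq norm_divide)
  moreover have "norm (primitive v) / v \<le> C"
    using norm_primitive_le(1)[of v] v by (simp add: field_simps)
  moreover have "norm (primitive v) / v \<le> max C L1_norm * v powr (- 1)"
    using norm_primitive_le(2)[of v] v by (auto simp: powr_minus divide_simps intro: max.coboundedI2)
  ultimately show "norm (running_mean f v) \<le> max C L1_norm"
      "norm (running_mean f v) \<le> max C L1_norm * v powr (- 1)" by simp_all
qed (use strip c_less_1 in auto)

text \<open>Integration by parts in the variable \<open>u = ln x\<close>. The boundary function
  \<open>G\<close> vanishes at minus infinity since \<open>primitive (exp u)\<close> is of order
  \<open>exp u\<close> and \<open>c > 0\<close>, and at plus infinity since the primitive is bounded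
  and \<open>c < 1\<close>.\<close>

lemma mellin_running_mean:
  "(1 - Complex c t) * mellin (running_mean f) (Complex c t) = mellin f (Complex c t)"
proof -
  interpret rm: mellin_strip "running_mean f" "max C L1_norm" 1 c by (rule mellin_strip_running_mean)
  let ?s = "Complex c t"
  define A where "A = (\<lambda>u. exp (?s * of_real u) * f (exp u))"
  define D where "D = (\<lambda>u. exp (?s * of_real u) * running_mean f (exp u))"
  define G where "G = (\<lambda>u. exp ((?s - 1) * of_real u) * primitive (exp u))"
  have A: "integrable lborel A" unfolding A_def by (rule integrable_exp)
  have D: "integrable lborel D" unfolding D_def by (rule rm.integrable_exp)
  have norm_G: "norm (G u) = exp ((c - 1) * u) * norm (primitive (exp u))" for u
    by (simp add: G_def norm_mult)
  have "(LBINT u=-\<infinity>..\<infinity>. A u - (1 - ?s) * D u) = 0 - 0"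
  proof (rule interval_integral_FTC_integrable[where F = G])
    fix u :: real
    have 1: "((primitive \<circ> exp) has_vector_derivative exp u *\<^sub>R f (exp u)) (at u)"
      by (rule vector_diff_chain_at)
         (auto intro!: has_vector_derivative_primitive DERIV_exp simp flip: has_real_derivative_iff_has_vector_derivative)
    have 2: "((\<lambda>u. exp ((?s - 1) * of_real u)) has_vector_derivative (?s - 1) * exp ((?s - 1) * of_real u)) (at u)"
      by (rule has_vector_derivative_real_field) (auto intro!: derivative_eq_intros)
    have e: "exp ((?s - 1) * of_real u) * of_real (exp u) = exp (?s * of_real u)"
      by (simp add: exp_of_real[symmetric] algebra_simps flip: exp_add)
    have "D u = exp ((?s - 1) * of_real u) * primitive (exp u)"
      unfolding D_def running_mean_eq e[symmetric] by simp
    moreover have "A u = exp ((?s - 1) * of_real u) * (exp u *\<^sub>R f (exp u))"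
      unfolding A_def e[symmetric] by (simp add: scaleR_conv_of_real)
    ultimately have "exp ((?s - 1) * of_real u) * (exp u *\<^sub>R f (exp u)) +
        (?s - 1) * exp ((?s - 1) * of_real u) * primitive (exp u) = A u - (1 - ?s) * D u"
      by (simp add: left_diff_distrib)
    then show "(G has_vector_derivative A u - (1 - ?s) * D u) (at u)"
      using has_vector_derivative_mult[OF 2 1] by (simp add: G_def o_def)
    have "isCont (\<lambda>u. f (exp u)) u" "isCont (\<lambda>u. primitive (exp u)) u"
      by (rule isCont_o2[where f = exp]; simp add: isCont isCont_primitive)+
    then show "isCont (\<lambda>u. A u - (1 - ?s) * D u) u"
      unfolding A_def D_def running_mean_eq by (intro continuous_intros) auto
  next
    show "set_integrable lborel (einterval (-\<infinity>) \<infinity>) (\<lambda>u. A u - (1 - ?s) * D u)"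
      using A D by (auto simp: set_integrable_def einterval_def)
    have "(G \<longlongrightarrow> 0) at_bot"
    proof (rule Lim_null_comparison)
      show "((\<lambda>u. C * exp (c * u)) \<longlongrightarrow> 0) at_bot" using strip by real_asymp
      have "norm (G u) \<le> C * exp (c * u)" for u
      proof -
        have "norm (G u) \<le> exp ((c - 1) * u) * (C * exp u)"
          unfolding norm_G by (intro mult_left_mono norm_primitive_le) auto
        also have "\<dots> = C * exp (c * u)"
          by (simp add: left_diff_distrib exp_diff)
        finally show ?thesis .
      qed
      then show "\<forall>\<^sub>F u in at_bot. norm (G u) \<le> C * exp (c * u)" by simp
    qed
    then show "((G \<circ> real_of_ereal) \<longlongrightarrow> 0) (at_right (-\<infinity>))" by (simp add: ereal_tendsto_simps)
    have "(G \<longlongrightarrow> 0) at_top"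
    proof (rule Lim_null_comparison)
      have "((\<lambda>u. exp (- (d * u)) * l) \<longlongrightarrow> 0) at_top" if "d > 0" for d l :: real
        using that by real_asymp
      from this[of "1 - c" L1_norm] show "((\<lambda>u. exp ((c - 1) * u) * L1_norm) \<longlongrightarrow> 0) at_top"
        using c_less_1 by (simp add: algebra_simps)
      have "norm (G u) \<le> exp ((c - 1) * u) * L1_norm" for u
        unfolding norm_G by (intro mult_left_mono norm_primitive_le) auto
      then show "\<forall>\<^sub>F u in at_top. norm (G u) \<le> exp ((c - 1) * u) * L1_norm" by simp
    qed
    then show "((G \<circ> real_of_ereal) \<longlongrightarrow> 0) (at_left \<infinity>)" by (simp add: ereal_tendsto_simps)
  qed auto
  then have "(LINT u|lborel. A u - (1 - ?s) * D u) = 0"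
    by (simp add: interval_lebesgue_integral_def set_lebesgue_integral_def einterval_def)
  then have "(LINT u|lborel. A u) = (1 - ?s) * (LINT u|lborel. D u)"
    using A D by simp
  then show ?thesis by (simp add: mellin_exp rm.mellin_exp A_def D_def)
qed

end

section \<open>From weighted inversion to the Muentz formula\<close>

context muntz
begin

lemma Complex_c_neq_1: "Complex c t \<noteq> 1"
  using c_less_1 by (auto simp: complex_eq_iff)

lemma isCont_zeta_mellin:
  assumes x: "x > 0"
  shows "isCont (\<lambda>t. of_real x powr (- Complex c t) * (zeta (Complex c t) * mellin f (Complex c t))) t"
proof -
  have [continuous_intros]: "isCont (Complex c) t"
    unfolding isCont_def by (intro tendsto_intros)
  have "continuous_on (- {1}) zeta"
    using is_zeta_zeta by (auto simp: is_zeta_def intro: holomorphic_on_imp_continuous_on)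
  then have "isCont zeta (Complex c t)"
    using Complex_c_neq_1 by (subst (asm) continuous_on_eq_continuous_at) auto
  then have "isCont (\<lambda>t. zeta (Complex c t)) t"
    by (intro isCont_o2[OF \<open>isCont (Complex c) t\<close>])
  then show ?thesis
    using x by (intro continuous_intros isCont_mellin) auto
qed

text \<open>Multiplication by a power \<open>n powr (- s)\<close> rescales \<open>x\<close> to
  \<open>n * x\<close>, and the correction term becomes an inverse transform of the running mean.
  Each summand can then be inverted separately.\<close>

lemma gauss_weight_zeta_approx:
  assumes x: "x > 0"
  shows "gauss_weight R t *\<^sub>R (of_real x powr (- Complex c t) * (zeta_approx N (Complex c t) * mellin f (Complex c t))) =
     (\<Sum>n<N. gauss_weight R t *\<^sub>R (of_real (real (Suc n) * x) powr (- Complex c t) * mellin f (Complex c t)))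
     - of_nat (Suc N) * (gauss_weight R t *\<^sub>R
         (of_real (real (Suc N) * x) powr (- Complex c t) * mellin (running_mean f) (Complex c t)))"
proof -
  let ?s = "Complex c t"
  have pw: "of_real (real (Suc n) * x) powr (- ?s) = of_nat (Suc n) powr (- ?s) * of_real x powr (- ?s)" for n
    using x powr_times_real[of "of_nat (Suc n)" "of_real x" "- ?s"] by simp
  have pw1: "of_nat (Suc N) powr (1 - ?s) = of_nat (Suc N) * of_nat (Suc N) powr (- ?s)"
    using powr_add[of "of_nat (Suc N) :: complex" 1 "- ?s"] by (simp add: powr_to_1 del: of_nat_Suc)
  have s1: "1 - ?s \<noteq> 0" using Complex_c_neq_1[of t] by auto
  have M: "mellin f ?s = (1 - ?s) * mellin (running_mean f) ?s" by (rule mellin_running_mean[symmetric])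
  have "zeta_approx N ?s * mellin f ?s = (\<Sum>n<N. of_nat (Suc n) powr (- ?s) * mellin f ?s)
      - of_nat (Suc N) * of_nat (Suc N) powr (- ?s) * mellin (running_mean f) ?s"
    unfolding zeta_approx_def left_diff_distrib sum_distrib_right pw1
    using s1 by (subst (2) M) (simp del: of_nat_Suc)
  then show ?thesis
    unfolding pw by (simp add: scaleR_conv_of_real sum_distrib_left right_diff_distrib mult_ac del: of_nat_Suc)
qed

lemma
  assumes R: "R > 0" and x: "x > 0"
  defines "V \<equiv> \<lambda>Z t. gauss_weight R t *\<^sub>R
      (of_real x powr (- Complex c t) * (Z (Complex c t) * mellin f (Complex c t)))"
  shows integral_gauss_weight_zeta_approx: "(LINT t|lborel. V (zeta_approx N) t) = of_real (2 * pi) *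
       ((\<Sum>n<N. mellin_smooth c R f (real (Suc n) * x)) -
         of_nat (Suc N) * mellin_smooth c R (running_mean f) (real (Suc N) * x))"
    and integrable_gauss_weight_zeta: "integrable lborel (V zeta)"
    and integral_gauss_weight_zeta_approx_tendsto:
      "(\<lambda>N. LINT t|lborel. V (zeta_approx N) t) \<longlonglongrightarrow> (LINT t|lborel. V zeta t)"
proof -
  interpret rm: mellin_strip "running_mean f" "max C L1_norm" 1 c by (rule mellin_strip_running_mean)
  have nx: "real (Suc n) * x > 0" for n using x by simp
  have i1: "integrable lborel (\<lambda>t. gauss_weight R t *\<^sub>R (of_real (real (Suc n) * x) powr (- Complex c t) * mellin f (Complex c t)))" for n
    by (rule integrable_gauss_weight_mellin[OF R nx])
  have i2: "integrable lborel (\<lambda>t. of_nat (Suc N) * (gauss_weight R t *\<^sub>R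
       (of_real (real (Suc N) * x) powr (- Complex c t) * mellin (running_mean f) (Complex c t))))" for N
    by (intro integrable_mult_right rm.integrable_gauss_weight_mellin[OF R nx])
  show "(LINT t|lborel. V (zeta_approx N) t) = of_real (2 * pi) *
       ((\<Sum>n<N. mellin_smooth c R f (real (Suc n) * x)) -
         of_nat (Suc N) * mellin_smooth c R (running_mean f) (real (Suc N) * x))"
    unfolding V_def gauss_weight_zeta_approx[OF x]
      Bochner_Integration.integral_diff[OF Bochner_Integration.integrable_sum[OF i1] i2]
      Bochner_Integration.integral_sum[OF i1] integral_mult_right_zero
      integral_gauss_weight_mellin[OF R nx] rm.integral_gauss_weight_mellin[OF R nx]
    by (simp add: sum_distrib_left right_diff_distrib mult_ac del: of_nat_Suc)
  define B where "B = (LINT u|lborel. exp (c * u) * norm (f (exp u)))"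
  define Z where "Z = (\<Sum>n. real (Suc n) powr (- (c + 1)))"
  \<comment> \<open>The linear bound on \<open>zeta_approx\<close>, sorted by powers of
    \<open>\<bar>t\<bar>\<close>, so that only the zeroth and first absolute moments of the weight
    occur. It is free of \<open>N\<close> and dominates the passage to \<open>zeta\<close>.\<close>
  define W where "W = (\<lambda>t. x powr (- c) * B * ((1 / (1 - c) + c * Z) * (gauss_weight R t * \<bar>t\<bar> ^ 0)
      + Z * (gauss_weight R t * \<bar>t\<bar> ^ 1)))"
  have W: "integrable lborel W"
    unfolding W_def by (intro integrable_mult_right Bochner_Integration.integrable_add integrable_gauss_weight_moment R)
  have VW: "norm (V (zeta_approx N) t) \<le> W t" for N t
  proof -
    have B0: "B \<ge> 0" using order_trans[OF norm_ge_zero mellin_bound] by (simp add: B_def)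
    have "norm (zeta_approx N (Complex c t)) * norm (mellin f (Complex c t)) \<le> (1 / (1 - c) + (c + \<bar>t\<bar>) * Z) * B"
    proof (rule mult_mono')
      show "norm (zeta_approx N (Complex c t)) \<le> 1 / (1 - c) + (c + \<bar>t\<bar>) * Z"
        unfolding Z_def using strip c_less_1 by (intro zeta_approx_bound) auto
      show "norm (mellin f (Complex c t)) \<le> B" unfolding B_def by (rule mellin_bound)
    qed auto
    then have "gauss_weight R t * (x powr (- c) * (norm (zeta_approx N (Complex c t)) * norm (mellin f (Complex c t))))
        \<le> gauss_weight R t * (x powr (- c) * ((1 / (1 - c) + (c + \<bar>t\<bar>) * Z) * B))"
      using gauss_weight_pos[of R t] by (intro mult_left_mono) auto
    moreover have "norm (V (zeta_approx N) t) =
        gauss_weight R t * (x powr (- c) * (norm (zeta_approx N (Complex c t)) * norm (mellin f (Complex c t))))"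
      using gauss_weight_pos[of R t] x by (simp add: V_def norm_mult norm_powr_real_powr)
    moreover have "gauss_weight R t * (x powr (- c) * ((1 / (1 - c) + (c + \<bar>t\<bar>) * Z) * B)) = W t"
      unfolding W_def by (simp add: algebra_simps)
    ultimately show ?thesis by linarith
  qed
  have m1: "V (zeta_approx N) \<in> borel_measurable lborel" for N
  proof -
    have "integrable lborel (V (zeta_approx N))"
      unfolding V_def gauss_weight_zeta_approx[OF x]
      by (intro Bochner_Integration.integrable_diff Bochner_Integration.integrable_sum i1 i2)
    then show ?thesis by (rule borel_measurable_integrable)
  qed
  have m2: "V zeta \<in> borel_measurable lborel"
  proof -
    have [measurable]: "(\<lambda>t. of_real x powr (- Complex c t) * (zeta (Complex c t) * mellin f (Complex c t)))
        \<in> borel_measurable borel"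
      by (intro borel_measurable_continuous_onI continuous_at_imp_continuous_on ballI isCont_zeta_mellin x)
    show ?thesis unfolding V_def by measurable
  qed
  have lim: "AE t in lborel. (\<lambda>N. V (zeta_approx N) t) \<longlonglongrightarrow> V zeta t"
    unfolding V_def using strip Complex_c_neq_1
    by (intro always_eventually allI tendsto_intros zeta_approx_tendsto) auto
  have bd: "AE t in lborel. norm (V (zeta_approx N) t) \<le> W t" for N
    using VW by simp
  show "integrable lborel (V zeta)"
    by (rule integrable_dominated_convergence[OF m2 m1 W lim bd])
  show "(\<lambda>N. LINT t|lborel. V (zeta_approx N) t) \<longlonglongrightarrow> (LINT t|lborel. V zeta t)"
    by (rule integral_dominated_convergence[OF m2 m1 W lim bd])
qed

text \<open>The factor \<open>Suc N\<close> cancels against the denominator of the running mean and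
  leaves the primitive at a point tending to infinity, hence the full integral of \<open>f\<close>.
  The remaining \<open>exp (- z / R)\<close> changes the tilt from \<open>c\<close> to
  \<open>c - 1\<close>.\<close>

lemma mellin_smooth_running_mean_tendsto:
  assumes R: "R \<ge> 1" and x: "x > 0"
  shows "(\<lambda>N. of_nat (Suc N) * mellin_smooth c R (running_mean f) (real (Suc N) * x)) \<longlonglongrightarrow>
     (LINT z|lborel. std_normal_density z *\<^sub>R of_real (exp ((c - 1) * (z / R)))) * ((LINT w:{0..}|lborel. f w) / of_real x)"
proof -
  let ?I = "LINT w:{0..}|lborel. f w"
  define K where "K = (\<lambda>N z. std_normal_density z *\<^sub>R (of_real (exp ((c - 1) * (z / R))) *
      (primitive (real (Suc N) * x * exp (z / R)) / of_real x)))"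
  have eq: "of_nat (Suc N) * mellin_smooth c R (running_mean f) (real (Suc N) * x) = (LINT z|lborel. K N z)" for N
  proof -
    have "of_nat (Suc N) * (std_normal_density z *\<^sub>R (of_real (exp (c * z / R)) *
        running_mean f (real (Suc N) * x * exp (z / R)))) = K N z" for z
    proof -
      define E X where "E = exp ((c - 1) * (z / R))" and "X = exp (z / R)"
      have "exp (c * z / R) = E * X"
        unfolding E_def X_def exp_add[symmetric] by (simp add: left_diff_distrib diff_divide_distrib)
      moreover have "X \<noteq> 0" by (simp add: X_def)
      ultimately show ?thesis
        using x unfolding K_def running_mean_eq E_def[symmetric] X_def[symmetric]
        by (simp add: scaleR_conv_of_real del: of_nat_Suc)
    qed
    then have "(LINT z|lborel. K N z) = (LINT z|lborel. of_nat (Suc N) * (std_normal_density z *\<^sub>R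
        (of_real (exp (c * z / R)) * running_mean f (real (Suc N) * x * exp (z / R)))))"
      by (simp only:)
    then show ?thesis unfolding mellin_smooth_def integral_mult_right_zero by (rule sym)
  qed
  have mp: "(\<lambda>z. primitive (real (Suc N) * x * exp (z / R))) \<in> borel_measurable borel" for N
  proof (intro borel_measurable_continuous_onI continuous_at_imp_continuous_on ballI)
    fix z
    show "isCont (\<lambda>z. primitive (real (Suc N) * x * exp (z / R))) z"
    proof (rule isCont_o2[where f = "\<lambda>z. real (Suc N) * x * exp (z / R)"])
      show "isCont (\<lambda>z. real (Suc N) * x * exp (z / R)) z" using R by (intro continuous_intros) auto
      show "isCont primitive (real (Suc N) * x * exp (z / R))" using x by (intro isCont_primitive) auto
    qed
  qed
  have "(\<lambda>N. LINT z|lborel. K N z) \<longlonglongrightarrow>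
      (LINT z|lborel. std_normal_density z *\<^sub>R (of_real (exp ((c - 1) * (z / R))) * (?I / of_real x)))"
  proof (rule integral_dominated_convergence[where w = "\<lambda>z. (L1_norm / x) * (std_normal_density z * exp (1 * \<bar>z\<bar>))"])
    show "integrable lborel (\<lambda>z. (L1_norm / x) * (std_normal_density z * exp (1 * \<bar>z\<bar>)))"
      by (intro integrable_mult_right integrable_std_normal_density_exp_abs)
    show "K N \<in> borel_measurable lborel" for N
      unfolding K_def using mp[of N] by measurable
    show "AE z in lborel. (\<lambda>N. K N z) \<longlonglongrightarrow> std_normal_density z *\<^sub>R (of_real (exp ((c - 1) * (z / R))) * (?I / of_real x))"
    proof (intro always_eventually allI)
      fix z
      have "filterlim (\<lambda>N. real (Suc N) * d) at_top sequentially" if "d > 0" for d :: real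
        using that by real_asymp
      from this[of "x * exp (z / R)"] have "filterlim (\<lambda>N. real (Suc N) * x * exp (z / R)) at_top sequentially"
        using x by (simp add: mult.assoc)
      from filterlim_compose[OF primitive_tendsto this]
      show "(\<lambda>N. K N z) \<longlonglongrightarrow> std_normal_density z *\<^sub>R (of_real (exp ((c - 1) * (z / R))) * (?I / of_real x))"
        unfolding K_def using x by (intro tendsto_intros) auto
    qed
    show "AE z in lborel. norm (K N z) \<le> (L1_norm / x) * (std_normal_density z * exp (1 * \<bar>z\<bar>))" for N
    proof (intro always_eventually allI)
      fix z
      have "\<bar>(c - 1) * (z / R)\<bar> \<le> 1 * \<bar>z\<bar>"
        unfolding abs_mult using strip c_less_1 R mult_left_mono[of 1 R "\<bar>z\<bar>"]
        by (intro mult_mono) (auto simp: field_simps)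
      from order_trans[OF abs_ge_self this]
      have e: "exp ((c - 1) * (z / R)) \<le> exp (1 * \<bar>z\<bar>)" by (subst exp_le_cancel_iff)
      have L: "norm (primitive (real (Suc N) * x * exp (z / R))) \<le> L1_norm"
        using x by (intro norm_primitive_le) auto
      have "norm (K N z) = std_normal_density z * (exp ((c - 1) * (z / R)) *
          (norm (primitive (real (Suc N) * x * exp (z / R))) / x))"
        using x by (simp add: K_def norm_mult norm_divide)
      also have "\<dots> \<le> std_normal_density z * (exp (1 * \<bar>z\<bar>) * (L1_norm / x))"
        using x L e by (intro mult_left_mono mult_mono divide_right_mono) auto
      finally show "norm (K N z) \<le> (L1_norm / x) * (std_normal_density z * exp (1 * \<bar>z\<bar>))"
        by (simp add: mult_ac)
    qed
  qed measurable
  also have "(LINT z|lborel. std_normal_density z *\<^sub>R (of_real (exp ((c - 1) * (z / R))) * (?I / of_real x))) =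
     (LINT z|lborel. (std_normal_density z *\<^sub>R of_real (exp ((c - 1) * (z / R)))) * (?I / of_real x))"
    by (simp only: scaleR_conv_of_real mult.assoc)
  finally show ?thesis unfolding eq integral_mult_left_zero .
qed

text \<open>The partial sums equal the weighted integral of \<open>zeta_approx\<close> over
  \<open>2 * pi\<close> plus the running mean term. Both converge with \<open>N\<close>, so
  convergence of the series is part of the result.\<close>

lemma mellin_smooth_sums:
  assumes R: "R \<ge> 1" and x: "x > 0"
  shows "(\<lambda>n. mellin_smooth c R f (real (Suc n) * x)) sums
     ((LINT t|lborel. gauss_weight R t *\<^sub>R (of_real x powr (- Complex c t) *
          (zeta (Complex c t) * mellin f (Complex c t)))) / of_real (2 * pi)
      + (LINT z|lborel. std_normal_density z *\<^sub>R of_real (exp ((c - 1) * (z / R)))) *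
          ((LINT w:{0..}|lborel. f w) / of_real x))"
proof -
  have R0: "R > 0" using R by simp
  have "(\<lambda>N. of_real (2 * pi) * ((\<Sum>n<N. mellin_smooth c R f (real (Suc n) * x)) -
         of_nat (Suc N) * mellin_smooth c R (running_mean f) (real (Suc N) * x)) / of_real (2 * pi)
       + of_nat (Suc N) * mellin_smooth c R (running_mean f) (real (Suc N) * x)) \<longlonglongrightarrow>
     ((LINT t|lborel. gauss_weight R t *\<^sub>R (of_real x powr (- Complex c t) *
          (zeta (Complex c t) * mellin f (Complex c t)))) / of_real (2 * pi)
      + (LINT z|lborel. std_normal_density z *\<^sub>R of_real (exp ((c - 1) * (z / R)))) *
          ((LINT w:{0..}|lborel. f w) / of_real x))"
    by (intro tendsto_add tendsto_divide tendsto_const mellin_smooth_running_mean_tendsto[OF R x]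
         integral_gauss_weight_zeta_approx_tendsto[OF R0 x, unfolded integral_gauss_weight_zeta_approx[OF R0 x]]) auto
  then show ?thesis by (simp add: sums_def del: of_nat_Suc)
qed

text \<open>Growth in \<open>u\<close> is harmless under a normal average, so the power bound is
  used for all \<open>u\<close>. The factor \<open>y powr (- \<alpha>)\<close> keeps the estimate
  summable over \<open>y = n * x\<close>.\<close>

lemma norm_exp_mult_f_le:
  assumes y: "y > 0"
  shows "norm (of_real (exp (c * u)) * f (y * exp u)) \<le> (C * y powr (- \<alpha>)) * exp (\<alpha> * \<bar>u\<bar>)"
proof -
  have "(c - \<alpha>) * u \<le> \<alpha> * \<bar>u\<bar>"
  proof -
    have "(c - \<alpha>) * u \<le> \<bar>c - \<alpha>\<bar> * \<bar>u\<bar>" by (metis abs_ge_self abs_mult)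
    also have "\<dots> \<le> \<alpha> * \<bar>u\<bar>" using strip by (intro mult_right_mono) auto
    finally show ?thesis .
  qed
  then have e: "exp ((c - \<alpha>) * u) \<le> exp (\<alpha> * \<bar>u\<bar>)" by simp
  have "norm (of_real (exp (c * u)) * f (y * exp u)) \<le> exp (c * u) * (C * (y * exp u) powr (- \<alpha>))"
    using bound_powr[of "y * exp u"] y by (simp add: norm_mult)
  also have "(y * exp u) powr (- \<alpha>) = y powr (- \<alpha>) * exp (- \<alpha> * u)"
    using y by (simp add: powr_mult) (simp add: powr_def)
  also have "exp (c * u) * (C * (y powr (- \<alpha>) * exp (- \<alpha> * u))) = (C * y powr (- \<alpha>)) * exp ((c - \<alpha>) * u)"
    by (simp add: left_diff_distrib exp_diff exp_minus field_simps)
  also have "\<dots> \<le> (C * y powr (- \<alpha>)) * exp (\<alpha> * \<bar>u\<bar>)"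
    using C_nonneg e by (intro mult_left_mono) auto
  finally show ?thesis .
qed

text \<open>Let \<open>R = Suc j\<close> tend to infinity in \<open>mellin_smooth_sums\<close>. The
  Abelian lemma turns the weighted integrals into the principal value \<open>L\<close>, the tilted
  normal averages tend to 1, and the smoothed values tend to the values of \<open>f\<close>.\<close>

theorem muntz_formula:
  assumes x: "x > 0" and L: "has_inverse_mellin c (\<lambda>s. zeta s * mellin f s) x L"
  shows "L = (\<Sum>n. f (real (Suc n) * x)) - (LINT w:{0..}|lborel. f w) / of_real x"
proof -
  let ?I = "LINT w:{0..}|lborel. f w"
  define \<phi> where "\<phi> = (\<lambda>t. of_real x powr (- Complex c t) * (zeta (Complex c t) * mellin f (Complex c t)))"
  have "((\<lambda>T. of_real (2 * pi) * (1 / (2 * of_real pi * \<i>) *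
        contour_integral (linepath (Complex c (- T)) (Complex c T))
          (\<lambda>s. of_real x powr (- s) * (zeta s * mellin f s)))) \<longlongrightarrow> of_real (2 * pi) * L) at_top"
    using L unfolding has_inverse_mellin_def by (intro tendsto_intros)
  moreover have "\<forall>\<^sub>F T in at_top. of_real (2 * pi) * (1 / (2 * of_real pi * \<i>) *
        contour_integral (linepath (Complex c (- T)) (Complex c T))
          (\<lambda>s. of_real x powr (- s) * (zeta s * mellin f s))) = integral {-T..T} \<phi>"
    using eventually_gt_at_top[of 0]
  proof eventually_elim
    case (elim T)
    have "contour_integral (linepath (Complex c (- T)) (Complex c T))
          (\<lambda>s. of_real x powr (- s) * (zeta s * mellin f s)) = \<i> * integral {-T..T} \<phi>"
      unfolding \<phi>_def by (rule contour_integral_linepath_same_Re) (use elim in auto)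
    then show ?case by simp
  qed
  ultimately have "((\<lambda>T. integral {-T..T} \<phi>) \<longlongrightarrow> of_real (2 * pi) * L) at_top"
    by (rule Lim_transform_eventually)
  then have lim1: "(\<lambda>j. LINT t|lborel. gauss_weight (real (Suc j)) t *\<^sub>R \<phi> t) \<longlonglongrightarrow> of_real (2 * pi) * L"
    by (rule gauss_weight_abelian[rotated])
       (use isCont_zeta_mellin[OF x] integrable_gauss_weight_zeta[OF _ x] in \<open>auto simp: \<phi>_def\<close>)
  have lim2: "(\<lambda>j. LINT z|lborel. std_normal_density z *\<^sub>R of_real (exp ((c - 1) * (z / real (Suc j))))) \<longlonglongrightarrow>
      complex_of_real (exp ((c - 1) * 0))"
  proof (rule std_normal_average_tendsto[where H = "\<lambda>u. of_real (exp ((c - 1) * u))" and M = 1 and a = 1])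
    fix u :: real
    have "(c - 1) * u \<le> \<bar>c - 1\<bar> * \<bar>u\<bar>" by (metis abs_ge_self abs_mult)
    also have "\<dots> \<le> 1 * \<bar>u\<bar>" using strip c_less_1 by (intro mult_right_mono) auto
    finally show "norm (complex_of_real (exp ((c - 1) * u))) \<le> 1 * exp (1 * \<bar>u\<bar>)" by simp
  qed (auto intro!: continuous_intros)
  have lim3: "(\<lambda>j. (LINT t|lborel. gauss_weight (real (Suc j)) t *\<^sub>R \<phi> t) / of_real (2 * pi)
      + (LINT z|lborel. std_normal_density z *\<^sub>R of_real (exp ((c - 1) * (z / real (Suc j))))) * (?I / of_real x))
      \<longlonglongrightarrow> of_real (2 * pi) * L / of_real (2 * pi) + complex_of_real (exp ((c - 1) * 0)) * (?I / of_real x)"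
    by (intro tendsto_intros lim1 lim2) auto
  have R: "real (Suc j) \<ge> 1" for j by simp
  have eq: "(LINT t|lborel. gauss_weight (real (Suc j)) t *\<^sub>R \<phi> t) / of_real (2 * pi)
      + (LINT z|lborel. std_normal_density z *\<^sub>R of_real (exp ((c - 1) * (z / real (Suc j))))) * (?I / of_real x) =
      (\<Sum>n. mellin_smooth c (real (Suc j)) f (real (Suc n) * x))" for j
    unfolding \<phi>_def by (rule sums_unique[OF mellin_smooth_sums[OF R x]])
  define D where "D = (LINT z|lborel. std_normal_density z * exp (\<alpha> * \<bar>z\<bar>))"
  define M where "M = (\<lambda>n. C * x powr (- \<alpha>) * D * real (Suc n) powr (- \<alpha>))"
  have smooth: "mellin_smooth c R f y =
      (LINT z|lborel. std_normal_density z *\<^sub>R (\<lambda>u. of_real (exp (c * u)) * f (y * exp u)) (z / R))" for R y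
    by (simp add: mellin_smooth_def)
  have meas: "(\<lambda>u. of_real (exp (c * u)) * f (y * exp u)) \<in> borel_measurable borel" if "y > 0" for y
    using borel_measurable_exp[OF that] by measurable
  \<comment> \<open>The limit in \<open>j\<close> is taken inside the sum by Tannery's theorem; the
    majorant \<open>M\<close> is a constant multiple of
    \<open>real (Suc n) powr (- \<alpha>)\<close>.\<close>
  have "(\<lambda>j. \<Sum>n. mellin_smooth c (real (Suc j)) f (real (Suc n) * x)) \<longlonglongrightarrow> (\<Sum>n. f (real (Suc n) * x))"
  proof (rule tannerys_theorem[where M = M, THEN conjunct2, THEN conjunct2])
    fix n
    have y: "real (Suc n) * x > 0" using x by simp
    have "(\<lambda>j. mellin_smooth c (real (Suc j)) f (real (Suc n) * x)) \<longlonglongrightarrow>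
        (\<lambda>u. of_real (exp (c * u)) * f (real (Suc n) * x * exp u)) 0"
      unfolding smooth
      by (rule std_normal_average_tendsto[OF meas[OF y] norm_exp_mult_f_le[OF y]])
         (use \<alpha>_gt_1 in \<open>auto intro!: continuous_intros isCont_o2[OF _ isCont]\<close>)
    then show "(\<lambda>j. mellin_smooth c (real (Suc j)) f (real (Suc n) * x)) \<longlonglongrightarrow> f (real (Suc n) * x)"
      by (simp del: of_nat_Suc)
  next
    have "norm (mellin_smooth c (real (Suc j)) f (real (Suc n) * x)) \<le> M n" for n j
    proof -
      have y: "real (Suc n) * x > 0" using x by simp
      have "norm (mellin_smooth c (real (Suc j)) f (real (Suc n) * x)) \<le> C * (real (Suc n) * x) powr (- \<alpha>) * D"
        unfolding smooth D_def
        by (rule std_normal_average_bound[OF meas[OF y] norm_exp_mult_f_le[OF y]]) (use \<alpha>_gt_1 in auto)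
      also have "\<dots> = M n" using x by (simp add: M_def powr_mult del: of_nat_Suc)
      finally show ?thesis .
    qed
    then show "\<forall>\<^sub>F (n, j) in at_top \<times>\<^sub>F sequentially.
        norm (mellin_smooth c (real (Suc j)) f (real (Suc n) * x)) \<le> M n"
      by (intro always_eventually) auto
    show "summable M" unfolding M_def by (intro summable_mult summable_Suc_powr \<alpha>_gt_1)
  qed auto
  from LIMSEQ_unique[OF lim3[unfolded eq] this] show ?thesis by (simp add: eq_diff_eq)
qed

end

section \<open>The summation formula\<close>

text \<open>The order estimate speaks only about large \<open>x\<close>; continuity on a compact
  interval covers the rest. The shift to \<open>1 + x\<close> keeps the bound finite at 0.\<close>

lemma continuous_decay_bound:
  fixes f :: "real \<Rightarrow> complex"
  assumes cont: "continuous_on UNIV f" and O: "(\<lambda>x. norm (f x)) \<in> O(\<lambda>x. x powr (- \<alpha>))" and \<alpha>: "\<alpha> > 0"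
  obtains C where "\<And>x. x \<ge> 0 \<Longrightarrow> norm (f x) \<le> C * (1 + x) powr (- \<alpha>)"
proof -
  obtain k where k: "k > 0" "\<forall>\<^sub>F x in at_top. norm (norm (f x)) \<le> k * norm (x powr (- \<alpha>))"
    using O by (elim landau_o.bigE)
  then obtain X0 where X0: "\<And>x. x \<ge> X0 \<Longrightarrow> norm (f x) \<le> k * x powr (- \<alpha>)"
    by (auto simp: eventually_at_top_linorder)
  define X where "X = max 1 X0"
  have "continuous_on {0..X} (\<lambda>x. norm (f x) * (1 + x) powr \<alpha>)"
    by (intro continuous_intros continuous_on_subset[OF cont]) auto
  then have "bounded ((\<lambda>x. norm (f x) * (1 + x) powr \<alpha>) ` {0..X})"
    by (intro compact_imp_bounded compact_continuous_image) auto
  then obtain B where "\<forall>y\<in>(\<lambda>x. norm (f x) * (1 + x) powr \<alpha>) ` {0..X}. norm y \<le> B"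
    unfolding bounded_iff by blast
  then have B: "norm (f x) * (1 + x) powr \<alpha> \<le> B" if "x \<in> {0..X}" for x
    using that by (auto simp: abs_mult)
  show ?thesis
  \<comment> \<open>The factor \<open>2 powr \<alpha>\<close> comes from
    \<open>1 + x \<le> 2 * x\<close> for \<open>x \<ge> 1\<close>.\<close>
  proof (rule that[of "max B (k * 2 powr \<alpha>)"])
    fix x :: real assume x: "x \<ge> 0"
    have inv: "(1 + x) powr \<alpha> * (1 + x) powr (- \<alpha>) = 1" using x by (simp add: powr_minus field_simps)
    have "norm (f x) * (1 + x) powr \<alpha> \<le> max B (k * 2 powr \<alpha>)"
    proof (cases "x \<le> X")
      case False
      then have x1: "x \<ge> 1" "x \<ge> X0" by (auto simp: X_def)
      have "norm (f x) * (1 + x) powr \<alpha> \<le> (k * x powr (- \<alpha>)) * (2 * x) powr \<alpha>"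
        using x1 k \<alpha> X0[OF x1(2)] by (intro mult_mono powr_mono2) auto
      also have "\<dots> = k * 2 powr \<alpha>" using x1 by (simp add: powr_mult powr_minus field_simps)
      finally show ?thesis by simp
    qed (use B[of x] x in auto)
    from mult_right_mono[OF this powr_ge_zero[of "1 + x" "- \<alpha>"]]
    show "norm (f x) \<le> max B (k * 2 powr \<alpha>) * (1 + x) powr (- \<alpha>)"
      by (simp add: mult.assoc inv)
  qed
qed

lemma fourier_cos_rescale:
  assumes "r > 0"
  shows "fourier_cos (\<lambda>u. f (u / r)) w = of_real r * fourier_cos f (r * w)"
proof -
  have eq: "indicator {0..} (0 + r * u) *\<^sub>R (of_real (cos (2 * pi * w * (0 + r * u))) * f ((0 + r * u) / r)) =
      indicator {0..} u *\<^sub>R (of_real (cos (2 * pi * (r * w) * u)) * f u)" for u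
    using assms by (auto simp: zero_le_mult_iff mult_ac split: split_indicator)
  have "fourier_cos (\<lambda>u. f (u / r)) w = \<bar>r\<bar> *\<^sub>R (LINT u|lborel. indicator {0..} (0 + r * u) *\<^sub>R
      (of_real (cos (2 * pi * w * (0 + r * u))) * f ((0 + r * u) / r)))"
    unfolding fourier_cos_def set_lebesgue_integral_def
    by (rule lborel_integral_real_affine) (use assms in simp)
  then show ?thesis
    unfolding eq using assms by (simp add: fourier_cos_def set_lebesgue_integral_def scaleR_conv_of_real)
qed

lemma norm_summable_atLeast_1:
  fixes F :: "nat \<Rightarrow> 'a :: banach"
  assumes "(\<lambda>k. norm (F k)) summable_on {1..}"
  shows "summable (\<lambda>k. norm (F (Suc k)))" and "infsum F {1..} = (\<Sum>k. F (Suc k))"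
proof -
  have bij: "bij_betw Suc UNIV {1..}"
    by (auto simp: bij_betw_def Suc_le_eq image_iff gr0_conv_Suc)
  have "(\<lambda>k. norm (F (Suc k))) summable_on UNIV"
    using assms summable_on_reindex_bij_betw[OF bij, of "\<lambda>k. norm (F k)"] by simp
  then show sm: "summable (\<lambda>k. norm (F (Suc k)))"
    by (simp add: summable_on_UNIV_nonneg_real_iff)
  have "infsum F {1..} = infsum (\<lambda>k. F (Suc k)) UNIV"
    using infsum_reindex_bij_betw[OF bij, of F] by simp
  also have "\<dots> = (\<Sum>k. F (Suc k))"
    by (intro infsumI norm_summable_imp_has_sum[OF sm] summable_sums summable_norm_cancel[OF sm])
  finally show "infsum F {1..} = (\<Sum>k. F (Suc k))" .
qed

theorem theorem1p1:
  fixes a b :: "nat \<Rightarrow> complex" and f :: "real \<Rightarrow> complex" and \<alpha> c :: real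
  assumes b_def: "\<And>n. n \<ge> 1 \<Longrightarrow> b n = (\<Sum>d | d dvd n. a d * of_int (moebius_mu (n div d)))"
    and f_cont: "continuous_on UNIV f"
    and f_L1: "integrable lborel f"
    and af_summable: "(\<lambda>n::int. norm (a (nat \<bar>n\<bar>) * f (of_int n))) summable_on {n. n \<noteq> 0}"
    and \<alpha>: "\<alpha> > 1"
    and f_decay: "(\<lambda>x. norm (f x)) \<in> O(\<lambda>x. x powr (- \<alpha>))"
    and c: "0 < c" "c < 1"
    and inverse_mellin_conv:
      "\<And>m. m \<ge> 1 \<Longrightarrow> \<exists>L. has_inverse_mellin c (\<lambda>s. zeta s * mellin f s) (1 / real m) L"
    and lhs_summable: "(\<lambda>n. norm (a n * fourier_cos f (real n))) summable_on {1..}"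
    and rhs_summable:
      "(\<lambda>m. norm (b m / of_nat m *
          (inverse_mellin c (\<lambda>s. zeta s * mellin f s) (1 / real m) + f 0 / 2)))
         summable_on {1..}"
    and double_summable:
      "(\<lambda>(m, k). norm (b m * fourier_cos f (real (m * k)))) summable_on ({1..} \<times> {1..})"
  shows "(\<Sum>\<^sub>\<infinity>n\<in>{1..}. a n * fourier_cos f (real n)) =
    1 / 2 * (\<Sum>\<^sub>\<infinity>m\<in>{1..}. b m / of_nat m *
      (inverse_mellin c (\<lambda>s. zeta s * mellin f s) (1 / real m) + f 0 / 2))"
proof -
  obtain C where C: "\<And>x. x \<ge> 0 \<Longrightarrow> norm (f x) \<le> C * (1 + x) powr (- \<alpha>)"
    using continuous_decay_bound[OF f_cont f_decay] \<alpha> by auto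
  have C0: "C \<ge> 0" using order_trans[OF norm_ge_zero C[of 0]] by simp
  interpret muntz f C \<alpha> c
  proof
    show "continuous_on {0<..} f" by (rule continuous_on_subset[OF f_cont]) auto
    show "isCont f x" for x using f_cont by (simp add: continuous_on_eq_continuous_at)
    show "set_integrable lborel {0..} f"
      using f_L1 unfolding set_integrable_def by (intro integrable_mult_indicator) auto
    fix v :: real assume v: "v > 0"
    have "(1 + v) powr (- \<alpha>) \<le> 1 powr (- \<alpha>)" "(1 + v) powr (- \<alpha>) \<le> v powr (- \<alpha>)"
      using v \<alpha> by (intro powr_mono2'; simp)+
    then have "C * (1 + v) powr (- \<alpha>) \<le> C" "C * (1 + v) powr (- \<alpha>) \<le> C * v powr (- \<alpha>)"
      using C0 by (auto intro: mult_left_mono mult_left_le)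
    with C[of v] v show "norm (f v) \<le> C" "norm (f v) \<le> C * v powr (- \<alpha>)" by linarith+
  qed (use \<alpha> c in auto)
  have key: "b m * (\<Sum>\<^sub>\<infinity>k\<in>{1..}. fourier_cos f (real (m * k))) = 1 / 2 * (b m / of_nat m *
      (inverse_mellin c (\<lambda>s. zeta s * mellin f s) (1 / real m) + f 0 / 2))" if m: "m \<ge> 1" for m
  \<comment> \<open>The double series yields summability of the inner cosine series only after
    division by \<open>b m\<close>; for \<open>b m = 0\<close> both sides vanish.\<close>
  proof (cases "b m = 0")
    case False
    let ?F = "\<lambda>k. fourier_cos f (real (m * k))"
    define g where "g = (\<lambda>u. f (u / real m))"
    have "(\<lambda>k. norm (b m * ?F k)) summable_on {1..}"
      using summable_on_SigmaD1[OF double_summable, of m] m by simp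
    then have "(\<lambda>k. norm (b m) * norm (?F k)) summable_on {1..}" by (simp add: norm_mult)
    then have "(\<lambda>k. norm (?F k)) summable_on {1..}"
      using False by (subst (asm) summable_on_cmult_right') auto
    note F = norm_summable_atLeast_1[OF this]
    have Fg: "fourier_cos g (real k) = of_nat m * ?F k" for k
      using fourier_cos_rescale[of "real m" f "real k"] m by (simp add: g_def)
    have "fourier_cos g 0 + 2 * (\<Sum>k. fourier_cos g (real (Suc k))) = g 0 / 2 + (\<Sum>k. g (real (Suc k)))"
    proof (rule poisson_summation_half_line[where C = "C * real m powr \<alpha>" and \<alpha> = \<alpha>])
      show "continuous_on {0..} g"
        unfolding g_def by (rule continuous_on_compose2[OF f_cont]) (use m in \<open>auto intro!: continuous_intros\<close>)
      have "integrable lborel g"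
        using lborel_integrable_real_affine[OF f_L1, of "1 / real m" 0] m by (simp add: g_def)
      then show "set_integrable lborel {0..} g"
        unfolding set_integrable_def by (intro integrable_mult_indicator) auto
      show "norm (g x) \<le> C * real m powr \<alpha> * (1 + x) powr (- \<alpha>)" if x: "x \<ge> 0" for x
      proof -
        have "norm (g x) \<le> C * (1 + x / real m) powr (- \<alpha>)"
          unfolding g_def using x by (intro C) auto
        \<comment> \<open>As \<open>m \<ge> 1\<close>, \<open>1 + x / m\<close> is at least
          \<open>(1 + x) / m\<close>; this produces the decay constant
          \<open>C * real m powr \<alpha>\<close> for \<open>g\<close>.\<close>
        also have "\<dots> \<le> C * ((1 + x) / real m) powr (- \<alpha>)"
          using x m \<alpha> C0 by (intro mult_left_mono powr_mono2') (auto simp: field_simps)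
        also have "\<dots> = C * real m powr \<alpha> * (1 + x) powr (- \<alpha>)"
          using x m by (simp add: powr_divide powr_minus field_simps)
        finally show ?thesis .
      qed
      show "summable (\<lambda>k. norm (fourier_cos g (real (Suc k))))"
        unfolding Fg norm_mult by (intro summable_mult F(1))
    qed (fact \<alpha>)
    moreover have "(\<Sum>k. fourier_cos g (real (Suc k))) = of_nat m * (\<Sum>k. ?F (Suc k))"
      unfolding Fg using suminf_mult[OF summable_norm_cancel[OF F(1)], of "of_nat m"] .
    moreover have "fourier_cos g 0 = of_nat m * (LINT w:{0..}|lborel. f w)"
      using Fg[of 0] by (simp add: fourier_cos_def)
    ultimately have poisson: "of_nat m * (LINT w:{0..}|lborel. f w) + 2 * (of_nat m * (\<Sum>k. ?F (Suc k))) =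
        f 0 / 2 + (\<Sum>k. f (real (Suc k) * (1 / real m)))"
      by (simp add: g_def del: of_nat_Suc)
    obtain L where L: "has_inverse_mellin c (\<lambda>s. zeta s * mellin f s) (1 / real m) L"
      using inverse_mellin_conv[OF m] by blast
    have "L = (\<Sum>k. f (real (Suc k) * (1 / real m))) - of_nat m * (LINT w:{0..}|lborel. f w)"
      using muntz_formula[OF _ L] m by (simp add: mult.commute)
    \<comment> \<open>Poisson summation and the Muentz formula share the sum of \<open>f\<close>
      over multiples of \<open>1 / m\<close> and the term \<open>m\<close> times the integral of
      \<open>f\<close>. Eliminating these expresses the cosine sum through \<open>L\<close> and
      \<open>f 0\<close>.\<close>
    with poisson have "2 * (of_nat m * (\<Sum>k. ?F (Suc k))) = L + f 0 / 2"
      by algebra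
    then have "(\<Sum>k. ?F (Suc k)) = (L + f 0 / 2) / (2 * of_nat m)"
      using m by (simp add: field_simps)
    then show ?thesis unfolding F(2) inverse_mellin_eqI[OF L] by simp
  qed simp
  have "(\<Sum>\<^sub>\<infinity>n\<in>{1..}. a n * fourier_cos f (real n)) =
      (\<Sum>\<^sub>\<infinity>n\<in>{1..}. (\<Sum>m | m dvd n. b m) * fourier_cos f (real n))"
    by (rule infsum_cong) (use moebius_inversion[OF b_def] in auto)
  also have "\<dots> = (\<Sum>\<^sub>\<infinity>m\<in>{1..}. b m * (\<Sum>\<^sub>\<infinity>k\<in>{1..}. fourier_cos f (real (m * k))))"
    by (rule infsum_divisor_sum[OF double_summable])
  also have "\<dots> = (\<Sum>\<^sub>\<infinity>m\<in>{1..}. 1 / 2 * (b m / of_nat m *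
      (inverse_mellin c (\<lambda>s. zeta s * mellin f s) (1 / real m) + f 0 / 2)))"
    by (rule infsum_cong) (use key in auto)
  also have "\<dots> = 1 / 2 * (\<Sum>\<^sub>\<infinity>m\<in>{1..}. b m / of_nat m *
      (inverse_mellin c (\<lambda>s. zeta s * mellin f s) (1 / real m) + f 0 / 2))"
    by (rule infsum_cmult_right')
  finally show ?thesis .
qed

end
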